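(* Let $\mathcal H$ be a complete Heyting algebra. Then the functor $a_{\mathbf{Shv}}=\Theta_{\mathbf{Shv}}\circ\Delta_{\mathbf{Inf}}:\mathbf{Set}^{\mathcal H^{op}}\to\mathbf{SHV}(\mathcal H)$ is left adjoint to the functor $\Theta_{\mathbf{Inf}}\circ\Delta_{\mathbf{Shv}}:\mathbf{SHV}(\mathcal H)\to\mathbf{Set}^{\mathcal H^{op}}$.
   Context: A relation $R:A\to B$ is a subset of $B\times A$; $R(b,a)=1$ means $(b,a)\in R$; $(S\circ R)(c,a)=1$ iff there is $b$ with $S(c,b)=1$ and $R(b,a)=1$; $R^{-1}$ is the inverse relation. An infima-preserving family $\tau:A\to B$ is a family of relations $\langle\tau_h:A\to B\rangle_{h\in\mathcal H}$ such that for all $a\in A,b\in B$ the set $\{h\mid\tau_h(b,a)=1\}$ is a principal down-set $\{k\mid k\le m\}$ for some $m\in\mathcal H$. The composite of infima-preserving families $\tau:A\to B$, $\sigma:B\to C$ is given by: $(\sigma\tau)_h(c,a)=1$ iff there is a (possibly empty) family $\langle k_i,l_i\rangle_{i\in I}$ in $\mathcal H$ with $h\le\bigvee_i(k_i\wedge l_i)$ and $(\sigma_{k_i}\circ\tau_{l_i})(c,a)=1$ for every $i$. Write $\tau\le\sigma$ if $\tau_h\subseteq\sigma_h$ for all $h$, and $\tau^\circ=\langle\tau_h^{-1}\rangle_h$. A relational-sheaf $F$ for $\mathcal H$ is a set $F( * )$ with an infima-preserving family $F=\langle F(h)\rangle_{h\in\mathcal H}:F( * )\to F( * )$ such that $F^\circ=F$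 and $F F=F$. A morphism $\theta:F\Rightarrow G$ of relational-sheaves is an infima-preserving family $\theta:F( * )\to G( * )$ with $\theta F=\theta=G\theta$, $F\le\theta^\circ\theta$ and $\theta\theta^\circ\le G$. Relational-sheaves and their morphisms, with morphisms composed by the composition $\sigma\tau$ of infima-preserving families and with $F$ as identity on $F$, form the category $\mathbf{Rel}^{\mathcal H^{co}}_{\mathbf{Inf}}$. For $h\in\mathcal H$, the singleton $S_h$ is the relational-sheaf with $S_h( * )=\{*\}$ and $S_h(k)( *,* )=1$ iff $k\le h$. For $k\le h$, $\alpha^{k,h}:S_k\Rightarrow S_h$ is the morphism with $\alpha^{k,h}_l( *,* )=1$ iff $l\le k$. $\mathbf{Set}^{\mathcal H^{op}}$ is the category of presheaves $\mathcal H^{op}\to\mathbf{Set}$ and natural transformations; for $x\in F(h)$ and $k\le h$, $x|_k=F(k\le h)(x)$. A matching family for a subset $A\subseteq\mathcal H$ and presheaf $F$ is a family $\langle x_k\rangle_{k\in A}$ with $x_k\in F(k)$ and $x_k|_{k\wedge l}=x_l|_{k\wedge l}$ for all $k,l\in A$; an amalgamation of it is $x\in F(\bigvee A)$ with $x|_k=x_k$ for all $k\in A$. $F$ is a sheaf if for every $A\subseteq\mathcal H$ every matching family has a unique amalgamation. $\mathbf{SHV}(\mathcal H)$ is the full subcategory of sheaves. $\Theta_{\mathbf{Inf}}:\mathbf{Rel}^{\mathcal H^{co}}_{\mathbf{Inf}}\to\mathbf{Set}^{\mathcal H^{op}}$: $\Theta_{\mathbf{Inf}}(G)(h)$ is the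 set of morphisms $\alpha:S_h\Rightarrow G$ of relational-sheaves, with restriction along $k\le h$ sending $\alpha$ to $\alpha\,\alpha^{k,h}$; $\Theta_{\mathbf{Inf}}(\tau)_h(\alpha)=\tau\alpha$. Its values are sheaves, and $\Theta_{\mathbf{Shv}}:\mathbf{Rel}^{\mathcal H^{co}}_{\mathbf{Inf}}\to\mathbf{SHV}(\mathcal H)$ denotes $\Theta_{\mathbf{Inf}}$ with codomain restricted to sheaves. $\Delta_{\mathbf{Inf}}:\mathbf{Set}^{\mathcal H^{op}}\to\mathbf{Rel}^{\mathcal H^{co}}_{\mathbf{Inf}}$: $\Delta_{\mathbf{Inf}}(F)( * )=\coprod_{h\in\mathcal H}F(h)$, and for $a\in F(k)$, $b\in F(l)$, $\Delta_{\mathbf{Inf}}(F)(h)(b,a)=1$ iff $h\le\bigvee\{m\mid m\le k\wedge l,\ b|_m=a|_m\}$; for $\tau:F\Rightarrow G$, $a\in F(k)$, $b\in G(l)$, $\Delta_{\mathbf{Inf}}(\tau)_h(b,a)=1$ iff $h\le\bigvee\{m\mid m\le k\wedge l,\ b|_m=\tau_k(a)|_m\}$. $\Delta_{\mathbf{Shv}}$ is the restriction of $\Delta_{\mathbf{Inf}}$ to $\mathbf{SHV}(\mathcal H)$. *)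

theory Defs
  imports Main "HOL-Library.FuncSet"
begin

class complete_heyting_algebra = complete_lattice +
  fixes heyting_imp :: "'a \<Rightarrow> 'a \<Rightarrow> 'a"
  assumes inf_le_iff_le_heyting_imp: "inf x y \<le> z \<longleftrightarrow> x \<le> heyting_imp y z"


section \<open>Categories and functors\<close>

text \<open>
  Arrows do not carry their endpoints: \<open>cmp C X Y Z g f\<close> is the composite of
  \<open>f : X \<rightarrow> Y\<close> and \<open>g : Y \<rightarrow> Z\<close>, and \<open>amap T X Y f\<close> is the image of \<open>f : X \<rightarrow> Y\<close>.
\<close>

record ('o, 'm) cat =
  obj :: "'o set"
  hom :: "'o \<Rightarrow> 'o \<Rightarrow> 'm set"
  cmp :: "'o \<Rightarrow> 'o \<Rightarrow> 'o \<Rightarrow> 'm \<Rightarrow> 'm \<Rightarrow> 'm"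
  ide :: "'o \<Rightarrow> 'm"

definition is_category :: "('o, 'm) cat \<Rightarrow> bool" where
  "is_category C \<longleftrightarrow>
     (\<forall>X\<in>obj C. ide C X \<in> hom C X X) \<and>
     (\<forall>X\<in>obj C. \<forall>Y\<in>obj C. \<forall>Z\<in>obj C. \<forall>f\<in>hom C X Y. \<forall>g\<in>hom C Y Z.
        cmp C X Y Z g f \<in> hom C X Z) \<and>
     (\<forall>X\<in>obj C. \<forall>Y\<in>obj C. \<forall>f\<in>hom C X Y.
        cmp C X X Y f (ide C X) = f \<and> cmp C X Y Y (ide C Y) f = f) \<and>
     (\<forall>W\<in>obj C. \<forall>X\<in>obj C. \<forall>Y\<in>obj C. \<forall>Z\<in>obj C.
        \<forall>f\<in>hom C W X. \<forall>g\<in>hom C X Y. \<forall>h\<in>hom C Y Z.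
        cmp C W X Z (cmp C X Y Z h g) f = cmp C W Y Z h (cmp C W X Y g f))"

record ('o, 'm, 'p, 'n) func =
  src :: "('o, 'm) cat"
  tgt :: "('p, 'n) cat"
  omap :: "'o \<Rightarrow> 'p"
  amap :: "'o \<Rightarrow> 'o \<Rightarrow> 'm \<Rightarrow> 'n"

definition is_functor :: "('o, 'm, 'p, 'n) func \<Rightarrow> bool" where
  "is_functor T \<longleftrightarrow>
     is_category (src T) \<and> is_category (tgt T) \<and>
     (\<forall>X\<in>obj (src T). omap T X \<in> obj (tgt T)) \<and>
     (\<forall>X\<in>obj (src T). \<forall>Y\<in>obj (src T). \<forall>f\<in>hom (src T) X Y.
        amap T X Y f \<in> hom (tgt T) (omap T X) (omap T Y)) \<and>
     (\<forall>X\<in>obj (src T). amap T X X (ide (src T) X) = ide (tgt T) (omap T X)) \<and>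
     (\<forall>X\<in>obj (src T). \<forall>Y\<in>obj (src T). \<forall>Z\<in>obj (src T).
        \<forall>f\<in>hom (src T) X Y. \<forall>g\<in>hom (src T) Y Z.
        amap T X Z (cmp (src T) X Y Z g f) =
          cmp (tgt T) (omap T X) (omap T Y) (omap T Z) (amap T Y Z g) (amap T X Y f))"

definition comp_func ::
  "('p, 'n, 'q, 'r) func \<Rightarrow> ('o, 'm, 'p, 'n) func \<Rightarrow> ('o, 'm, 'q, 'r) func"
  (infixr \<open>\<circ>\<^sub>F\<close> 55) where
  "S \<circ>\<^sub>F T =
     \<lparr>src = src T, tgt = tgt S,
      omap = (\<lambda>X. omap S (omap T X)),
      amap = (\<lambda>X Y f. amap S (omap T X) (omap T Y) (amap T X Y f))\<rparr>"


section \<open>Presheaves and sheaves\<close>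

text \<open>\<open>rst F h k x\<close> is the restriction of \<open>x \<in> F(h)\<close> to \<open>k \<le> h\<close>; only such values matter.\<close>

record ('h, 'a) presheaf =
  sec :: "'h \<Rightarrow> 'a set"
  rst :: "'h \<Rightarrow> 'h \<Rightarrow> 'a \<Rightarrow> 'a"

definition is_presheaf :: "('h::order, 'a) presheaf \<Rightarrow> bool" where
  "is_presheaf F \<longleftrightarrow>
     (\<forall>h k. k \<le> h \<longrightarrow> rst F h k \<in> sec F h \<rightarrow> sec F k) \<and>
     (\<forall>h. \<forall>x\<in>sec F h. rst F h h x = x) \<and>
     (\<forall>h k l. l \<le> k \<longrightarrow> k \<le> h \<longrightarrow> (\<forall>x\<in>sec F h. rst F k l (rst F h k x) = rst F h l x))"

type_synonym ('h, 'a, 'b) nat_trans = "'h \<Rightarrow> 'a \<Rightarrow> 'b"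

definition nt_hom ::
  "('h::order, 'a) presheaf \<Rightarrow> ('h, 'b) presheaf \<Rightarrow> ('h, 'a, 'b) nat_trans set" where
  "nt_hom F G =
     {\<tau>. (\<forall>h. \<tau> h \<in> sec F h \<rightarrow>\<^sub>E sec G h) \<and>
         (\<forall>h k. k \<le> h \<longrightarrow> (\<forall>x\<in>sec F h. \<tau> k (rst F h k x) = rst G h k (\<tau> h x)))}"

text \<open>The argument \<open>F\<close> is the domain of \<open>\<tau>\<close>.\<close>

definition nt_comp ::
  "('h, 'a) presheaf \<Rightarrow> ('h, 'b, 'c) nat_trans \<Rightarrow> ('h, 'a, 'b) nat_trans
     \<Rightarrow> ('h, 'a, 'c) nat_trans" where
  "nt_comp F \<sigma> \<tau> = (\<lambda>h. compose (sec F h) (\<sigma> h) (\<tau> h))"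

definition PSh :: "(('h::order, 'a) presheaf, ('h, 'a, 'a) nat_trans) cat" where
  "PSh = \<lparr>obj = {F. is_presheaf F}, hom = nt_hom,
          cmp = (\<lambda>F G K \<sigma> \<tau>. nt_comp F \<sigma> \<tau>), ide = (\<lambda>F h. \<lambda>x\<in>sec F h. x)\<rparr>"

definition matching_family ::
  "('h::complete_lattice, 'a) presheaf \<Rightarrow> 'h set \<Rightarrow> ('h \<Rightarrow> 'a) \<Rightarrow> bool" where
  "matching_family F A x \<longleftrightarrow>
     (\<forall>k\<in>A. x k \<in> sec F k) \<and>
     (\<forall>k\<in>A. \<forall>l\<in>A. rst F k (inf k l) (x k) = rst F l (inf k l) (x l))"

definition amalgamation ::
  "('h::complete_lattice, 'a) presheaf \<Rightarrow> 'h set \<Rightarrow> ('h \<Rightarrow> 'a) \<Rightarrow> 'a \<Rightarrow> bool" where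
  "amalgamation F A x s \<longleftrightarrow> s \<in> sec F (Sup A) \<and> (\<forall>k\<in>A. rst F (Sup A) k s = x k)"

definition is_sheaf :: "('h::complete_lattice, 'a) presheaf \<Rightarrow> bool" where
  "is_sheaf F \<longleftrightarrow> is_presheaf F \<and>
     (\<forall>A x. matching_family F A x \<longrightarrow> (\<exists>!s. amalgamation F A x s))"

definition SHV :: "(('h::complete_lattice, 'a) presheaf, ('h, 'a, 'a) nat_trans) cat" where
  "SHV = PSh\<lparr>obj := {F. is_sheaf F}\<rparr>"


section \<open>Infima-preserving families and relational-sheaves\<close>

text \<open>A family of relations from \<open>A\<close> to \<open>B\<close>; as a set of pairs, each member is a subset of \<open>B \<times> A\<close>.\<close>

type_synonym ('h, 'a, 'b) relfam = "'h \<Rightarrow> ('b \<times> 'a) set"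

definition inf_family :: "'a set \<Rightarrow> 'b set \<Rightarrow> ('h::order, 'a, 'b) relfam \<Rightarrow> bool" where
  "inf_family A B \<tau> \<longleftrightarrow>
     (\<forall>h. \<tau> h \<subseteq> B \<times> A) \<and> (\<forall>a\<in>A. \<forall>b\<in>B. \<exists>m. {h. (b, a) \<in> \<tau> h} = {..m})"

text \<open>
  Composite of \<open>\<tau> : A \<rightarrow> B\<close> and \<open>\<sigma> : B \<rightarrow> C\<close>. A family of pairs \<open>(k\<^sub>i, l\<^sub>i)\<close> enters only through
  the set \<open>P\<close> of its members. The empty \<open>P\<close> gives all of \<open>C \<times> A\<close> at the bottom element, which
  is why the outer carriers are arguments. With pairs ordered (target, source), the
  composite \<open>\<sigma> k \<circ> \<tau> l\<close> is the library's \<open>\<sigma> k O \<tau> l\<close>.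
\<close>

definition fam_comp ::
  "'a set \<Rightarrow> 'c set \<Rightarrow> ('h::complete_lattice, 'b, 'c) relfam \<Rightarrow> ('h, 'a, 'b) relfam
     \<Rightarrow> ('h, 'a, 'c) relfam" where
  "fam_comp A C \<sigma> \<tau> = (\<lambda>h. {(c, a). c \<in> C \<and> a \<in> A \<and>
     (\<exists>P :: ('h \<times> 'h) set. h \<le> (SUP (k, l)\<in>P. inf k l) \<and> (\<forall>(k, l)\<in>P. (c, a) \<in> \<sigma> k O \<tau> l))})"

definition fam_le :: "('h, 'a, 'b) relfam \<Rightarrow> ('h, 'a, 'b) relfam \<Rightarrow> bool" where
  "fam_le \<tau> \<sigma> \<longleftrightarrow> (\<forall>h. \<tau> h \<subseteq> \<sigma> h)"

definition fam_conv :: "('h, 'a, 'b) relfam \<Rightarrow> ('h, 'b, 'a) relfam" where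
  "fam_conv \<tau> = (\<lambda>h. (\<tau> h)\<inverse>)"

record ('h, 'a) relsheaf =
  car :: "'a set"
  rel :: "('h, 'a, 'a) relfam"

definition is_relsheaf :: "('h::complete_lattice, 'a) relsheaf \<Rightarrow> bool" where
  "is_relsheaf F \<longleftrightarrow>
     inf_family (car F) (car F) (rel F) \<and> fam_conv (rel F) = rel F \<and>
     fam_comp (car F) (car F) (rel F) (rel F) = rel F"

definition rel_hom ::
  "('h::complete_lattice, 'a) relsheaf \<Rightarrow> ('h, 'b) relsheaf \<Rightarrow> ('h, 'a, 'b) relfam set" where
  "rel_hom F G = {\<theta>. inf_family (car F) (car G) \<theta> \<and>
     fam_comp (car F) (car G) \<theta> (rel F) = \<theta> \<and>
     fam_comp (car F) (car G) (rel G) \<theta> = \<theta> \<and>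
     fam_le (rel F) (fam_comp (car F) (car F) (fam_conv \<theta>) \<theta>) \<and>
     fam_le (fam_comp (car G) (car G) \<theta> (fam_conv \<theta>)) (rel G)}"

definition RelInf :: "(('h::complete_lattice, 'a) relsheaf, ('h, 'a, 'a) relfam) cat" where
  "RelInf = \<lparr>obj = {F. is_relsheaf F}, hom = rel_hom,
             cmp = (\<lambda>F G K \<sigma> \<tau>. fam_comp (car F) (car K) \<sigma> \<tau>), ide = rel\<rparr>"

definition singleton_relsheaf :: "'h::order \<Rightarrow> ('h, unit) relsheaf" where
  "singleton_relsheaf h = \<lparr>car = {()}, rel = (\<lambda>k. if k \<le> h then {((), ())} else {})\<rparr>"

text \<open>The morphism \<open>\<alpha>\<^bsup>k,h\<^esup> : S\<^sub>k \<Rightarrow> S\<^sub>h\<close>; as a family it does not depend on \<open>h\<close>.\<close>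

definition singleton_incl :: "'h::order \<Rightarrow> ('h, unit, unit) relfam" where
  "singleton_incl k = (\<lambda>l. if l \<le> k then {((), ())} else {})"


section \<open>The functors between presheaves and relational-sheaves\<close>

definition Theta_obj ::
  "('h::complete_lattice, 'b) relsheaf \<Rightarrow> ('h, ('h, unit, 'b) relfam) presheaf" where
  "Theta_obj G =
     \<lparr>sec = (\<lambda>h. rel_hom (singleton_relsheaf h) G),
      rst = (\<lambda>h k \<alpha>. fam_comp {()} (car G) \<alpha> (singleton_incl k))\<rparr>"

definition Theta_arr ::
  "('h::complete_lattice, 'b) relsheaf \<Rightarrow> ('h, 'c) relsheaf \<Rightarrow> ('h, 'b, 'c) relfam
     \<Rightarrow> ('h, ('h, unit, 'b) relfam, ('h, unit, 'c) relfam) nat_trans" where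
  "Theta_arr F G \<tau> = (\<lambda>h. \<lambda>\<alpha>\<in>rel_hom (singleton_relsheaf h) F. fam_comp {()} (car G) \<tau> \<alpha>)"

definition Theta_Inf ::
  "(('h::complete_lattice, 'b) relsheaf, ('h, 'b, 'b) relfam,
    ('h, ('h, unit, 'b) relfam) presheaf,
    ('h, ('h, unit, 'b) relfam, ('h, unit, 'b) relfam) nat_trans) func" where
  "Theta_Inf = \<lparr>src = RelInf, tgt = PSh, omap = Theta_obj, amap = Theta_arr\<rparr>"

definition Theta_Shv ::
  "(('h::complete_lattice, 'b) relsheaf, ('h, 'b, 'b) relfam,
    ('h, ('h, unit, 'b) relfam) presheaf,
    ('h, ('h, unit, 'b) relfam, ('h, unit, 'b) relfam) nat_trans) func" where
  "Theta_Shv = Theta_Inf\<lparr>tgt := SHV\<rparr>"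

definition Delta_obj :: "('h::complete_lattice, 'a) presheaf \<Rightarrow> ('h, 'h \<times> 'a) relsheaf" where
  "Delta_obj F =
     \<lparr>car = (SIGMA h : UNIV. sec F h),
      rel = (\<lambda>h. {((l, b), (k, a)). b \<in> sec F l \<and> a \<in> sec F k \<and>
               h \<le> Sup {m. m \<le> inf k l \<and> rst F l m b = rst F k m a}})\<rparr>"

definition Delta_arr ::
  "('h::complete_lattice, 'a) presheaf \<Rightarrow> ('h, 'b) presheaf \<Rightarrow> ('h, 'a, 'b) nat_trans
     \<Rightarrow> ('h, 'h \<times> 'a, 'h \<times> 'b) relfam" where
  "Delta_arr F G \<tau> = (\<lambda>h. {((l, b), (k, a)). b \<in> sec G l \<and> a \<in> sec F k \<and>
     h \<le> Sup {m. m \<le> inf k l \<and> rst G l m b = rst G k m (\<tau> k a)}})"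

definition Delta_Inf ::
  "(('h::complete_lattice, 'a) presheaf, ('h, 'a, 'a) nat_trans,
    ('h, 'h \<times> 'a) relsheaf, ('h, 'h \<times> 'a, 'h \<times> 'a) relfam) func" where
  "Delta_Inf = \<lparr>src = PSh, tgt = RelInf, omap = Delta_obj, amap = Delta_arr\<rparr>"

definition Delta_Shv ::
  "(('h::complete_lattice, 'a) presheaf, ('h, 'a, 'a) nat_trans,
    ('h, 'h \<times> 'a) relsheaf, ('h, 'h \<times> 'a, 'h \<times> 'a) relfam) func" where
  "Delta_Shv = Delta_Inf\<lparr>src := SHV\<rparr>"

definition a_Shv ::
  "(('h::complete_lattice, 'a) presheaf, ('h, 'a, 'a) nat_trans,
    ('h, ('h, unit, 'h \<times> 'a) relfam) presheaf,
    ('h, ('h, unit, 'h \<times> 'a) relfam, ('h, unit, 'h \<times> 'a) relfam) nat_trans) func" where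
  "a_Shv = Theta_Shv \<circ>\<^sub>F Delta_Inf"


section \<open>Adjunction\<close>

text \<open>
  The composites of the functors above change the type in which the sections of a presheaf
  live, so no single HOL type can serve as the universe of sets for both functors. Hence the
  sections of the presheaves in the source of \<open>L\<close> live in \<open>'a\<close>, those of the presheaves in the
  source of \<open>R\<close> live in \<open>'b\<close>, and the arrows \<open>L F \<rightarrow> G\<close> and \<open>F \<rightarrow> R G\<close> are natural
  transformations between presheaves over different types, as provided by the polymorphic
  \<^const>\<open>nt_hom\<close>. Both \<open>L\<close> and \<open>R\<close> are meant to go between full subcategories of presheaves.
  The property is: a bijection of arrows \<open>L F \<rightarrow> G\<close> with arrows \<open>F \<rightarrow> R G\<close>, natural in \<open>F\<close> and \<open>G\<close>.
\<close>

definition left_adjoint ::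
  "(('h::order, 'a) presheaf, ('h, 'a, 'a) nat_trans,
    ('h, 'c) presheaf, ('h, 'c, 'c) nat_trans) func \<Rightarrow>
   (('h, 'b) presheaf, ('h, 'b, 'b) nat_trans,
    ('h, 'd) presheaf, ('h, 'd, 'd) nat_trans) func \<Rightarrow> bool" where
  "left_adjoint L R \<longleftrightarrow> is_functor L \<and> is_functor R \<and>
     (\<exists>\<phi> :: ('h, 'a) presheaf \<Rightarrow> ('h, 'b) presheaf \<Rightarrow>
           ('h, 'c, 'b) nat_trans \<Rightarrow> ('h, 'a, 'd) nat_trans.
        (\<forall>F\<in>obj (src L). \<forall>G\<in>obj (src R).
           bij_betw (\<phi> F G) (nt_hom (omap L F) G) (nt_hom F (omap R G))) \<and>
        (\<forall>F\<in>obj (src L). \<forall>F'\<in>obj (src L). \<forall>G\<in>obj (src R). \<forall>G'\<in>obj (src R).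
           \<forall>\<alpha>\<in>hom (src L) F' F. \<forall>\<beta>\<in>hom (src R) G G'. \<forall>f\<in>nt_hom (omap L F) G.
             \<phi> F' G' (nt_comp (omap L F') \<beta> (nt_comp (omap L F') f (amap L F' F \<alpha>))) =
             nt_comp F' (amap R G G' \<beta>) (nt_comp F' (\<phi> F G f) \<alpha>)))"

end

theory Submission
  imports Defs
begin

text \<open>
  An infima-preserving family is an \<open>\<H>\<close>-valued matrix, and composition is the matrix
  product with suprema as sums and infima as products. A section of \<open>\<Theta>\<Delta>F\<close> over \<open>h\<close> is then a
  function \<open>\<alpha>\<close> on the elements of \<open>F\<close>, where \<open>\<alpha>(x)\<close> is the extent to which \<open>\<alpha>\<close> is \<open>x\<close>.
  Sending \<open>x\<close> to its local agreement with other elements gives \<open>\<eta> : F \<rightarrow> \<Theta>\<Delta>F\<close>. It is locally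
  surjective, since \<open>\<alpha>\<close> and \<open>\<eta>(x)\<close> coincide on \<open>\<alpha>(x)\<close> and these elements cover \<open>h\<close>; and it is
  bijective if \<open>F\<close> is a sheaf. Hence a morphism \<open>f : \<Theta>\<Delta>F \<rightarrow> G\<close> into a sheaf is determined by
  \<open>f \<circ> \<eta>\<^sub>F\<close>, and the transpose of \<open>f\<close> is \<open>\<eta>\<^sub>G \<circ> f \<circ> \<eta>\<^sub>F\<close>: every \<open>g : F \<rightarrow> \<Theta>\<Delta>G\<close> is the transpose of
  \<open>\<eta>\<^sub>G\<^sup>-\<^sup>1 \<circ> \<Theta>\<Delta>(\<eta>\<^sub>G\<^sup>-\<^sup>1 \<circ> g)\<close>.
\<close>

section \<open>Infima-preserving families as matrices of truth values\<close>

text \<open>Meeting with \<open>x\<close> has the implication as right adjoint and so preserves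
  suprema. In this form a meet of suprema is bounded one member at a time. The Heyting axiom is
  invoked here only; all later distributivity goes through this equivalence.\<close>

lemma SUP_inf_le_iff:
  fixes x z :: "'h::complete_heyting_algebra"
  shows "inf (SUP i\<in>I. f i) x \<le> z \<longleftrightarrow> (\<forall>i\<in>I. inf (f i) x \<le> z)"
  by (simp add: inf_le_iff_le_heyting_imp SUP_le_iff)

lemma inf_SUP_le_iff:
  fixes x z :: "'h::complete_heyting_algebra"
  shows "inf x (SUP i\<in>I. f i) \<le> z \<longleftrightarrow> (\<forall>i\<in>I. inf x (f i) \<le> z)"
  using SUP_inf_le_iff[of f I x z] by (simp add: inf.commute)

lemma Sup_inf_Sup_le_iff:
  fixes z :: "'h::complete_heyting_algebra"
  shows "inf (Sup A) (Sup B) \<le> z \<longleftrightarrow> (\<forall>x\<in>A. \<forall>y\<in>B. inf x y \<le> z)"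
  using SUP_inf_le_iff[of "\<lambda>x. x" A "Sup B" z] inf_SUP_le_iff[where f="\<lambda>x. x" and I=B and z=z]
  by simp

lemma inf_Sup_distrib:
  fixes x :: "'h::complete_heyting_algebra"
  shows "inf x (Sup A) = (SUP y\<in>A. inf x y)"
proof (rule order.antisym)
  show "inf x (Sup A) \<le> (SUP y\<in>A. inf x y)"
    using inf_SUP_le_iff[of x "\<lambda>y. y" A "SUP y\<in>A. inf x y"] by (simp add: SUP_upper)
qed (auto intro!: SUP_least intro: le_infI2 Sup_upper)

section \<open>Translation between families and matrices\<close>

definition truth :: "('h::complete_lattice, 'a, 'b) relfam \<Rightarrow> 'b \<Rightarrow> 'a \<Rightarrow> 'h" where
  "truth \<tau> b a = Sup {h. (b, a) \<in> \<tau> h}"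

definition of_truth :: "'a set \<Rightarrow> 'b set \<Rightarrow> ('b \<Rightarrow> 'a \<Rightarrow> 'h) \<Rightarrow> ('h::order, 'a, 'b) relfam" where
  "of_truth A B M = (\<lambda>h. {(b, a). b \<in> B \<and> a \<in> A \<and> h \<le> M b a})"

lemma inf_family_of_truth [simp]: "inf_family A B (of_truth A B M)"
  by (auto simp: inf_family_def of_truth_def)

lemma truth_of_truth [simp]:
  fixes M :: "'b \<Rightarrow> 'a \<Rightarrow> 'h::complete_lattice"
  assumes "b \<in> B" "a \<in> A"
  shows "truth (of_truth A B M) b a = M b a"
proof -
  have "{h. (b, a) \<in> of_truth A B M h} = {..M b a}"
    using assms by (auto simp: of_truth_def)
  then show ?thesis
    by (auto simp: truth_def intro!: Sup_eqI)
qed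

text \<open>The principal down-set condition says that the supremum in \<open>truth\<close> is
  attained, so membership at a level becomes an inequality. This is the dictionary between families
  and matrices.\<close>

lemma inf_family_mem_iff:
  assumes "inf_family A B \<tau>"
  shows "(b, a) \<in> \<tau> h \<longleftrightarrow> b \<in> B \<and> a \<in> A \<and> h \<le> truth \<tau> b a"
proof (cases "b \<in> B \<and> a \<in> A")
  case True
  then obtain m where m: "{h. (b, a) \<in> \<tau> h} = {..m}"
    using assms unfolding inf_family_def by blast
  then have "truth \<tau> b a = m"
    by (auto simp: truth_def intro!: Sup_eqI)
  with m True show ?thesis by auto
next
  case False
  with assms show ?thesis unfolding inf_family_def by blast
qed

lemma inf_family_eqI:
  assumes "inf_family A B \<tau>" "inf_family A B \<sigma>"
    and "\<And>a b. a \<in> A \<Longrightarrow> b \<in> B \<Longrightarrow> truth \<tau> b a = truth \<sigma> b a"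
  shows "\<tau> = \<sigma>"
  by (rule ext, rule set_eqI)
    (use assms in \<open>auto simp: inf_family_mem_iff[OF assms(1)] inf_family_mem_iff[OF assms(2)]\<close>)

lemma fam_le_iff:
  assumes "inf_family A B \<tau>" "inf_family A B \<sigma>"
  shows "fam_le \<tau> \<sigma> \<longleftrightarrow> (\<forall>a\<in>A. \<forall>b\<in>B. truth \<tau> b a \<le> truth \<sigma> b a)"
proof
  assume le: "fam_le \<tau> \<sigma>"
  show "\<forall>a\<in>A. \<forall>b\<in>B. truth \<tau> b a \<le> truth \<sigma> b a"
  proof (intro ballI)
    fix a b assume "a \<in> A" "b \<in> B"
    \<comment> \<open>The truth value is itself a level at which the pair is related, so inclusion
      at this one level gives the inequality.\<close>
    then have "(b, a) \<in> \<tau> (truth \<tau> b a)"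
      by (simp add: inf_family_mem_iff[OF assms(1)])
    with le have "(b, a) \<in> \<sigma> (truth \<tau> b a)"
      unfolding fam_le_def by blast
    then show "truth \<tau> b a \<le> truth \<sigma> b a"
      by (simp add: inf_family_mem_iff[OF assms(2)])
  qed
next
  assume "\<forall>a\<in>A. \<forall>b\<in>B. truth \<tau> b a \<le> truth \<sigma> b a"
  then show "fam_le \<tau> \<sigma>"
    unfolding fam_le_def
    using order_trans
    by (fastforce simp: inf_family_mem_iff[OF assms(1)] inf_family_mem_iff[OF assms(2)])
qed

lemma truth_fam_conv [simp]: "truth (fam_conv \<tau>) a b = truth \<tau> b a"
  by (simp add: truth_def fam_conv_def)

lemma inf_family_fam_conv [simp]: "inf_family A B \<tau> \<Longrightarrow> inf_family B A (fam_conv \<tau>)"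
  unfolding inf_family_def fam_conv_def by auto

text \<open>A pair \<open>(k, l)\<close> in \<open>P\<close> comes with an intermediate
  \<open>b\<close>, and \<open>inf k l\<close> lies below the summand at that \<open>b\<close>.
  Hence the supremum over all \<open>b\<close> is the best bound that any \<open>P\<close> can
  reach.\<close>

lemma fam_comp_eq_of_truth:
  assumes \<tau>: "inf_family A B \<tau>" and \<sigma>: "inf_family B C \<sigma>"
  shows "fam_comp A C \<sigma> \<tau> = of_truth A C (\<lambda>c a. SUP b\<in>B. inf (truth \<sigma> c b) (truth \<tau> b a))"
proof -
  have "(\<exists>P. h \<le> (SUP (k, l)\<in>P. inf k l) \<and> (\<forall>(k, l)\<in>P. (c, a) \<in> \<sigma> k O \<tau> l)) \<longleftrightarrow>
      h \<le> (SUP b\<in>B. inf (truth \<sigma> c b) (truth \<tau> b a))"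
    if "c \<in> C" "a \<in> A" for c a h
  proof
    assume "\<exists>P. h \<le> (SUP (k, l)\<in>P. inf k l) \<and> (\<forall>(k, l)\<in>P. (c, a) \<in> \<sigma> k O \<tau> l)"
    then obtain P where P: "h \<le> (SUP (k, l)\<in>P. inf k l)"
      "\<And>k l. (k, l) \<in> P \<Longrightarrow> (c, a) \<in> \<sigma> k O \<tau> l" by blast
    have "(SUP (k, l)\<in>P. inf k l) \<le> (SUP b\<in>B. inf (truth \<sigma> c b) (truth \<tau> b a))"
    proof (rule SUP_least, clarify)
      fix k l assume "(k, l) \<in> P"
      then obtain b where "(c, b) \<in> \<sigma> k" "(b, a) \<in> \<tau> l" using P(2) by blast
      then have b: "b \<in> B" and "k \<le> truth \<sigma> c b" "l \<le> truth \<tau> b a"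
        by (auto simp: inf_family_mem_iff[OF \<tau>] inf_family_mem_iff[OF \<sigma>])
      then have "inf k l \<le> inf (truth \<sigma> c b) (truth \<tau> b a)" by (blast intro: inf_mono)
      then show "inf k l \<le> (SUP b\<in>B. inf (truth \<sigma> c b) (truth \<tau> b a))"
        using b by (blast intro: SUP_upper2)
    qed
    with P(1) show "h \<le> (SUP b\<in>B. inf (truth \<sigma> c b) (truth \<tau> b a))" by (rule order_trans)
  next
    assume h: "h \<le> (SUP b\<in>B. inf (truth \<sigma> c b) (truth \<tau> b a))"
    \<comment> \<open>One pair per intermediate \<open>b\<close>, with the largest admissible
      levels; it is a legitimate choice because both truth values are attained.\<close>
    let ?P = "(\<lambda>b. (truth \<sigma> c b, truth \<tau> b a)) ` B"
    have "h \<le> (SUP (k, l)\<in>?P. inf k l)"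
      using h by (simp add: image_image)
    moreover have "\<forall>(k, l)\<in>?P. (c, a) \<in> \<sigma> k O \<tau> l"
      using that by (auto simp: inf_family_mem_iff[OF \<tau>] inf_family_mem_iff[OF \<sigma>])
    ultimately show "\<exists>P. h \<le> (SUP (k, l)\<in>P. inf k l) \<and> (\<forall>(k, l)\<in>P. (c, a) \<in> \<sigma> k O \<tau> l)"
      by blast
  qed
  then show ?thesis
    by (auto simp: fam_comp_def of_truth_def fun_eq_iff)
qed

lemma inf_family_fam_comp:
  "inf_family A B \<tau> \<Longrightarrow> inf_family B C \<sigma> \<Longrightarrow> inf_family A C (fam_comp A C \<sigma> \<tau>)"
  by (simp add: fam_comp_eq_of_truth)

lemma truth_fam_comp:
  "inf_family A B \<tau> \<Longrightarrow> inf_family B C \<sigma> \<Longrightarrow> a \<in> A \<Longrightarrow> c \<in> C \<Longrightarrow>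
    truth (fam_comp A C \<sigma> \<tau>) c a = (SUP b\<in>B. inf (truth \<sigma> c b) (truth \<tau> b a))"
  by (simp add: fam_comp_eq_of_truth)

text \<open>Associativity of the matrix product: distributivity turns both sides into a supremum
  over all \<open>b\<close> and \<open>c\<close> of the same triple meet.\<close>

lemma fam_comp_assoc:
  fixes \<tau> :: "('h::complete_heyting_algebra, 'a, 'b) relfam"
  assumes \<tau>: "inf_family A B \<tau>" and \<sigma>: "inf_family B C \<sigma>" and \<rho>: "inf_family C D \<rho>"
  shows "fam_comp A D (fam_comp B D \<rho> \<sigma>) \<tau> = fam_comp A D \<rho> (fam_comp A C \<sigma> \<tau>)"
proof (rule inf_family_eqI)
  note \<sigma>\<tau> = inf_family_fam_comp[OF \<tau> \<sigma>] and \<rho>\<sigma> = inf_family_fam_comp[OF \<sigma> \<rho>]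
  show "inf_family A D (fam_comp A D (fam_comp B D \<rho> \<sigma>) \<tau>)"
    "inf_family A D (fam_comp A D \<rho> (fam_comp A C \<sigma> \<tau>))"
    using \<tau> \<rho> \<sigma>\<tau> \<rho>\<sigma> by (blast intro: inf_family_fam_comp)+
  fix a d assume a: "a \<in> A" and d: "d \<in> D"
  have "(SUP b\<in>B. inf (SUP c\<in>C. inf (truth \<rho> d c) (truth \<sigma> c b)) (truth \<tau> b a))
      = (SUP c\<in>C. inf (truth \<rho> d c) (SUP b\<in>B. inf (truth \<sigma> c b) (truth \<tau> b a)))"
    (is "?l = ?r")
  proof (rule order.antisym)
    show "?l \<le> ?r"
    proof (clarsimp simp: SUP_le_iff SUP_inf_le_iff)
      fix b c assume "b \<in> B" "c \<in> C"
      then have "inf (truth \<rho> d c) (inf (truth \<sigma> c b) (truth \<tau> b a)) \<le> ?r"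
        by (intro SUP_upper2[of c] inf_mono order_refl SUP_upper2[of b])
      then show "inf (inf (truth \<rho> d c) (truth \<sigma> c b)) (truth \<tau> b a) \<le> ?r"
        by (simp add: inf.assoc)
    qed
    show "?r \<le> ?l"
    proof (clarsimp simp: SUP_le_iff inf_SUP_le_iff)
      fix b c assume "b \<in> B" "c \<in> C"
      then have "inf (inf (truth \<rho> d c) (truth \<sigma> c b)) (truth \<tau> b a) \<le> ?l"
        by (intro SUP_upper2[of b] inf_mono order_refl SUP_upper2[of c])
      then show "inf (truth \<rho> d c) (inf (truth \<sigma> c b) (truth \<tau> b a)) \<le> ?l"
        by (simp add: inf.assoc)
    qed
  qed
  then show "truth (fam_comp A D (fam_comp B D \<rho> \<sigma>) \<tau>) d a
      = truth (fam_comp A D \<rho> (fam_comp A C \<sigma> \<tau>)) d a"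
    using a d
    by (simp add: truth_fam_comp[OF \<tau> \<rho>\<sigma>] truth_fam_comp[OF \<sigma>\<tau> \<rho>] truth_fam_comp[OF \<tau> \<sigma>]
        truth_fam_comp[OF \<sigma> \<rho>])
qed


section \<open>Relational-sheaves and their morphisms\<close>

text \<open>
  In terms of truth values, relational-sheaves are sets with a symmetric and transitive
  \<open>\<H>\<close>-valued equality, and their morphisms are the total, single-valued relations
  that respect it.
\<close>

abbreviation eqv :: "('h::complete_lattice, 'a) relsheaf \<Rightarrow> 'a \<Rightarrow> 'a \<Rightarrow> 'h" where
  "eqv F \<equiv> truth (rel F)"

text \<open>Transitivity bounds every summand of the matrix square. The summand at
  \<open>z = y\<close> reaches the entry, since going from \<open>y\<close> to \<open>x\<close> and
  back gives \<open>eqv F y x \<le> eqv F y y\<close>.\<close>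

lemma relsheafI:
  assumes fam: "inf_family (car F) (car F) (rel F)"
    and sym: "\<And>x y. x \<in> car F \<Longrightarrow> y \<in> car F \<Longrightarrow> eqv F x y = eqv F y x"
    and trans: "\<And>x y z. x \<in> car F \<Longrightarrow> y \<in> car F \<Longrightarrow> z \<in> car F \<Longrightarrow>
      inf (eqv F x y) (eqv F y z) \<le> eqv F x z"
  shows "is_relsheaf F"
proof -
  have "fam_conv (rel F) = rel F"
    using fam sym by (intro inf_family_eqI[of "car F" "car F"]) auto
  moreover have "fam_comp (car F) (car F) (rel F) (rel F) = rel F"
  proof (intro inf_family_eqI[of "car F" "car F"] fam inf_family_fam_comp[OF fam fam])
    fix x y assume xy: "x \<in> car F" "y \<in> car F"
    have "eqv F y x \<le> eqv F y y"
      using trans[of y x y] sym[of x y] xy by simp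
    then have "eqv F y x \<le> inf (eqv F y y) (eqv F y x)" by simp
    then have "(SUP z\<in>car F. inf (eqv F y z) (eqv F z x)) = eqv F y x"
      using xy trans by (intro order.antisym SUP_least SUP_upper2[of y]) auto
    then show "truth (fam_comp (car F) (car F) (rel F) (rel F)) y x = eqv F y x"
      using xy by (simp add: truth_fam_comp[OF fam fam])
  qed
  ultimately show ?thesis using fam by (simp add: is_relsheaf_def)
qed

text \<open>Transitivity is one summand of the idempotence equation. The diagonal entry
  \<open>eqv F x x\<close> acts as the extent of \<open>x\<close> and bounds its row and
  column.\<close>

lemma relsheafD:
  assumes "is_relsheaf F"
  shows relsheaf_inf_family: "inf_family (car F) (car F) (rel F)"
    and relsheaf_sym: "eqv F x y = eqv F y x"
    and relsheaf_trans: "x \<in> car F \<Longrightarrow> y \<in> car F \<Longrightarrow> z \<in> car F \<Longrightarrow>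
      inf (eqv F x y) (eqv F y z) \<le> eqv F x z"
    and relsheaf_le_left: "x \<in> car F \<Longrightarrow> y \<in> car F \<Longrightarrow> eqv F x y \<le> eqv F x x"
    and relsheaf_le_right: "x \<in> car F \<Longrightarrow> y \<in> car F \<Longrightarrow> eqv F x y \<le> eqv F y y"
proof -
  show fam: "inf_family (car F) (car F) (rel F)"
    using assms by (simp add: is_relsheaf_def)
  have conv: "fam_conv (rel F) = rel F" and idem: "fam_comp (car F) (car F) (rel F) (rel F) = rel F"
    using assms by (simp_all add: is_relsheaf_def)
  show sym: "eqv F x y = eqv F y x" for x y
    by (metis conv truth_fam_conv)
  have eq: "eqv F x z = (SUP y\<in>car F. inf (eqv F x y) (eqv F y z))"
    if "x \<in> car F" "z \<in> car F" for x z
    using truth_fam_comp[OF fam fam that(2,1)] idem by simp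
  show trans: "inf (eqv F x y) (eqv F y z) \<le> eqv F x z"
    if "x \<in> car F" "y \<in> car F" "z \<in> car F" for x y z
    unfolding eq[OF that(1,3)] using that(2) by (rule SUP_upper)
  show le: "eqv F x y \<le> eqv F x x" if "x \<in> car F" "y \<in> car F" for x y
    using trans[of x y x] that sym[of x y] by simp
  show "eqv F x y \<le> eqv F y y" if "x \<in> car F" "y \<in> car F" for x y
    using le[of y x] that sym[of x y] by simp
qed

text \<open>The four matrix conditions of \<open>rel_hom\<close> are split into entrywise ones:
  strictness and the two extensionality rules yield neutrality of \<open>F\<close> and
  \<open>G\<close>, and the last two are totality and single-valuedness.\<close>

lemma rel_homI:
  fixes F :: "('h::complete_heyting_algebra, 'a) relsheaf" and G :: "('h, 'b) relsheaf"
  assumes F: "is_relsheaf F" and G: "is_relsheaf G" and fam: "inf_family (car F) (car G) \<theta>"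
    and strict: "\<And>x y. x \<in> car F \<Longrightarrow> y \<in> car G \<Longrightarrow> truth \<theta> y x \<le> eqv F x x"
    and ext_left: "\<And>x x' y. x \<in> car F \<Longrightarrow> x' \<in> car F \<Longrightarrow> y \<in> car G \<Longrightarrow>
      inf (truth \<theta> y x) (eqv F x x') \<le> truth \<theta> y x'"
    and ext_right: "\<And>x y y'. x \<in> car F \<Longrightarrow> y \<in> car G \<Longrightarrow> y' \<in> car G \<Longrightarrow>
      inf (eqv G y' y) (truth \<theta> y x) \<le> truth \<theta> y' x"
    and total: "\<And>x. x \<in> car F \<Longrightarrow> eqv F x x \<le> (SUP y\<in>car G. truth \<theta> y x)"
    and single: "\<And>x y y'. x \<in> car F \<Longrightarrow> y \<in> car G \<Longrightarrow> y' \<in> car G \<Longrightarrow>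
      inf (truth \<theta> y x) (truth \<theta> y' x) \<le> eqv G y y'"
  shows "\<theta> \<in> rel_hom F G"
proof -
  note famF = relsheaf_inf_family[OF F] and famG = relsheaf_inf_family[OF G]
    and famC = inf_family_fam_conv[OF fam]
  have "fam_comp (car F) (car G) \<theta> (rel F) = \<theta>"
  proof (intro inf_family_eqI[of "car F" "car G"] fam inf_family_fam_comp[OF famF fam])
    fix x y assume xy: "x \<in> car F" "y \<in> car G"
    then have "(SUP x'\<in>car F. inf (truth \<theta> y x') (eqv F x' x)) = truth \<theta> y x"
      by (intro order.antisym SUP_least SUP_upper2[of x]) (auto intro: ext_left strict)
    then show "truth (fam_comp (car F) (car G) \<theta> (rel F)) y x = truth \<theta> y x"
      using xy by (simp add: truth_fam_comp[OF famF fam])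
  qed
  moreover have "fam_comp (car F) (car G) (rel G) \<theta> = \<theta>"
  proof (intro inf_family_eqI[of "car F" "car G"] fam inf_family_fam_comp[OF fam famG])
    fix x y assume xy: "x \<in> car F" "y \<in> car G"
    \<comment> \<open>Single-valuedness with \<open>y' = y\<close> is strictness on the target side,
      so the summand at \<open>y' = y\<close> already equals the entry.\<close>
    then have "truth \<theta> y x \<le> eqv G y y" using single[of x y y] by simp
    with xy have "(SUP y'\<in>car G. inf (eqv G y y') (truth \<theta> y' x)) = truth \<theta> y x"
      by (intro order.antisym SUP_least SUP_upper2[of y]) (auto intro: ext_right)
    then show "truth (fam_comp (car F) (car G) (rel G) \<theta>) y x = truth \<theta> y x"
      using xy by (simp add: truth_fam_comp[OF fam famG])
  qed
  moreover have "fam_le (rel F) (fam_comp (car F) (car F) (fam_conv \<theta>) \<theta>)"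
  proof (clarsimp simp: fam_le_iff[OF famF inf_family_fam_comp[OF fam famC]]
      truth_fam_comp[OF fam famC])
    fix x' x assume xx: "x' \<in> car F" "x \<in> car F"
    let ?S = "SUP y\<in>car G. inf (truth \<theta> y x) (truth \<theta> y x')"
    have "eqv F x x' \<le> (SUP y\<in>car G. truth \<theta> y x)"
      using relsheaf_le_left[OF F] total xx by (blast intro: order_trans)
    \<comment> \<open>Totality at \<open>x\<close> supplies values \<open>y\<close>; on the part
      where \<open>x\<close> equals \<open>x'\<close>, extensionality carries each of them over to
      \<open>x'\<close>.\<close>
    moreover have "inf (SUP y\<in>car G. truth \<theta> y x) (eqv F x x') \<le> ?S"
      unfolding SUP_inf_le_iff
    proof
      fix y assume y: "y \<in> car G"
      then have "inf (truth \<theta> y x) (eqv F x x') \<le> inf (truth \<theta> y x) (truth \<theta> y x')"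
        using ext_left xx by simp
      also have "\<dots> \<le> ?S" using y by (rule SUP_upper)
      finally show "inf (truth \<theta> y x) (eqv F x x') \<le> ?S" .
    qed
    ultimately show "eqv F x x' \<le> ?S" by (simp add: inf.absorb2)
  qed
  moreover have "fam_le (fam_comp (car G) (car G) \<theta> (fam_conv \<theta>)) (rel G)"
    using single
    by (auto simp: fam_le_iff[OF inf_family_fam_comp[OF famC fam] famG]
        truth_fam_comp[OF famC fam] intro!: SUP_least)
  ultimately show ?thesis using fam by (simp add: rel_hom_def)
qed

text \<open>Conversely, each property is read off from a single summand or entry of one of the four
  matrix conditions; totality is the diagonal case of
  \<open>F \<le> \<theta>\<degree>\<theta>\<close>.\<close>

lemma rel_homD:
  fixes F :: "('h::complete_heyting_algebra, 'a) relsheaf" and G :: "('h, 'b) relsheaf"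
  assumes \<theta>: "\<theta> \<in> rel_hom F G" and F: "is_relsheaf F" and G: "is_relsheaf G"
  shows rel_hom_inf_family: "inf_family (car F) (car G) \<theta>"
    and rel_hom_strict: "x \<in> car F \<Longrightarrow> y \<in> car G \<Longrightarrow> truth \<theta> y x \<le> eqv F x x"
    and rel_hom_ext_left: "x \<in> car F \<Longrightarrow> x' \<in> car F \<Longrightarrow> y \<in> car G \<Longrightarrow>
      inf (truth \<theta> y x) (eqv F x x') \<le> truth \<theta> y x'"
    and rel_hom_ext_right: "x \<in> car F \<Longrightarrow> y \<in> car G \<Longrightarrow> y' \<in> car G \<Longrightarrow>
      inf (eqv G y' y) (truth \<theta> y x) \<le> truth \<theta> y' x"
    and rel_hom_total: "x \<in> car F \<Longrightarrow> eqv F x x \<le> (SUP y\<in>car G. truth \<theta> y x)"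
    and rel_hom_single: "x \<in> car F \<Longrightarrow> y \<in> car G \<Longrightarrow> y' \<in> car G \<Longrightarrow>
      inf (truth \<theta> y x) (truth \<theta> y' x) \<le> eqv G y y'"
proof -
  show fam: "inf_family (car F) (car G) \<theta>"
    using \<theta> by (simp add: rel_hom_def)
  note famF = relsheaf_inf_family[OF F] and famG = relsheaf_inf_family[OF G]
    and famC = inf_family_fam_conv[OF fam]
  have eqF: "truth \<theta> y x = (SUP x'\<in>car F. inf (truth \<theta> y x') (eqv F x' x))"
    if "x \<in> car F" "y \<in> car G" for x y
    using truth_fam_comp[OF famF fam that] \<theta> by (simp add: rel_hom_def)
  have eqG: "truth \<theta> y x = (SUP y'\<in>car G. inf (eqv G y y') (truth \<theta> y' x))"
    if "x \<in> car F" "y \<in> car G" for x y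
    using truth_fam_comp[OF fam famG that] \<theta> by (simp add: rel_hom_def)
  have tot: "eqv F x x' \<le> (SUP y\<in>car G. inf (truth \<theta> y x) (truth \<theta> y x'))"
    if "x \<in> car F" "x' \<in> car F" for x x'
    using \<theta> that
    by (simp add: rel_hom_def fam_le_iff[OF famF inf_family_fam_comp[OF fam famC]]
        truth_fam_comp[OF fam famC])
  have sing: "(SUP x\<in>car F. inf (truth \<theta> y x) (truth \<theta> y' x)) \<le> eqv G y y'"
    if "y \<in> car G" "y' \<in> car G" for y y'
    using \<theta> that
    by (auto simp: rel_hom_def fam_le_iff[OF inf_family_fam_comp[OF famC fam] famG]
        truth_fam_comp[OF famC fam])
  show "truth \<theta> y x \<le> eqv F x x" if "x \<in> car F" "y \<in> car G"
    unfolding eqF[OF that] using that relsheaf_le_right[OF F]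
    by (auto intro!: SUP_least le_infI2)
  show "inf (truth \<theta> y x) (eqv F x x') \<le> truth \<theta> y x'"
    if "x \<in> car F" "x' \<in> car F" "y \<in> car G"
    unfolding eqF[OF that(2,3)] using that(1) by (rule SUP_upper)
  show "inf (eqv G y' y) (truth \<theta> y x) \<le> truth \<theta> y' x"
    if "x \<in> car F" "y \<in> car G" "y' \<in> car G"
    unfolding eqG[OF that(1,3)] using that(2) by (rule SUP_upper)
  show "eqv F x x \<le> (SUP y\<in>car G. truth \<theta> y x)" if "x \<in> car F"
    using tot[OF that that] by simp
  show "inf (truth \<theta> y x) (truth \<theta> y' x) \<le> eqv G y y'"
    if "x \<in> car F" "y \<in> car G" "y' \<in> car G"
    using sing[OF that(2,3)] that(1) by (auto simp: SUP_le_iff)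
qed

lemma rel_hom_comp:
  fixes F :: "('h::complete_heyting_algebra, 'a) relsheaf" and G :: "('h, 'b) relsheaf"
    and K :: "('h, 'c) relsheaf"
  assumes F: "is_relsheaf F" and G: "is_relsheaf G" and K: "is_relsheaf K"
    and \<theta>: "\<theta> \<in> rel_hom F G" and \<sigma>: "\<sigma> \<in> rel_hom G K"
  shows "fam_comp (car F) (car K) \<sigma> \<theta> \<in> rel_hom F K"
proof (rule rel_homI[OF F K])
  note fam\<theta> = rel_hom_inf_family[OF \<theta> F G] and fam\<sigma> = rel_hom_inf_family[OF \<sigma> G K]
  note [simp] = truth_fam_comp[OF fam\<theta> fam\<sigma>]
  show "inf_family (car F) (car K) (fam_comp (car F) (car K) \<sigma> \<theta>)"
    by (rule inf_family_fam_comp[OF fam\<theta> fam\<sigma>])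
  fix x assume x: "x \<in> car F"
  show "truth (fam_comp (car F) (car K) \<sigma> \<theta>) z x \<le> eqv F x x" if "z \<in> car K" for z
    using x that rel_hom_strict[OF \<theta> F G] by (auto intro!: SUP_least le_infI2)
  show "inf (truth (fam_comp (car F) (car K) \<sigma> \<theta>) z x) (eqv F x x')
      \<le> truth (fam_comp (car F) (car K) \<sigma> \<theta>) z x'" if "x' \<in> car F" "z \<in> car K" for x' z
  proof (simp add: x that SUP_inf_le_iff, rule ballI)
    fix y assume y: "y \<in> car G"
    have "inf (inf (truth \<sigma> z y) (truth \<theta> y x)) (eqv F x x') \<le> inf (truth \<sigma> z y) (truth \<theta> y x')"
      using rel_hom_ext_left[OF \<theta> F G x that(1) y] by (simp add: inf.assoc le_infI2)
    also have "\<dots> \<le> (SUP y\<in>car G. inf (truth \<sigma> z y) (truth \<theta> y x'))"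
      using y by (rule SUP_upper)
    finally show "inf (inf (truth \<sigma> z y) (truth \<theta> y x)) (eqv F x x') \<le> \<dots>" .
  qed
  show "inf (eqv K z' z) (truth (fam_comp (car F) (car K) \<sigma> \<theta>) z x)
      \<le> truth (fam_comp (car F) (car K) \<sigma> \<theta>) z' x" if "z \<in> car K" "z' \<in> car K" for z z'
  proof (simp add: x that inf_SUP_le_iff, rule ballI)
    fix y assume y: "y \<in> car G"
    have "inf (eqv K z' z) (inf (truth \<sigma> z y) (truth \<theta> y x)) \<le> inf (truth \<sigma> z' y) (truth \<theta> y x)"
      using rel_hom_ext_right[OF \<sigma> G K y that] by (simp add: inf.assoc[symmetric] le_infI1)
    also have "\<dots> \<le> (SUP y\<in>car G. inf (truth \<sigma> z' y) (truth \<theta> y x))"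
      using y by (rule SUP_upper)
    finally show "inf (eqv K z' z) (inf (truth \<sigma> z y) (truth \<theta> y x)) \<le> \<dots>" .
  qed
  show "eqv F x x \<le> (SUP z\<in>car K. truth (fam_comp (car F) (car K) \<sigma> \<theta>) z x)"
  proof (rule order_trans[OF rel_hom_total[OF \<theta> F G x]], rule SUP_least)
    fix y assume y: "y \<in> car G"
    \<comment> \<open>To the extent that \<open>y\<close> is a value of \<open>\<theta>\<close> it
      exists in \<open>G\<close>, and there totality of \<open>\<sigma>\<close> applies.\<close>
    have "truth \<theta> y x \<le> eqv G y y" using rel_hom_single[OF \<theta> F G x y y] by simp
    also have "\<dots> \<le> (SUP z\<in>car K. truth \<sigma> z y)" by (rule rel_hom_total[OF \<sigma> G K y])
    finally have "truth \<theta> y x = inf (SUP z\<in>car K. truth \<sigma> z y) (truth \<theta> y x)"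
      by (simp add: inf.absorb2)
    also have "\<dots> \<le> (SUP z\<in>car K. truth (fam_comp (car F) (car K) \<sigma> \<theta>) z x)"
      unfolding SUP_inf_le_iff using x y by (auto intro!: SUP_upper2[of _ "car K"] SUP_upper)
    finally show "truth \<theta> y x \<le> \<dots>" .
  qed
  show "inf (truth (fam_comp (car F) (car K) \<sigma> \<theta>) z x) (truth (fam_comp (car F) (car K) \<sigma> \<theta>) z' x)
      \<le> eqv K z z'" if "z \<in> car K" "z' \<in> car K" for z z'
  proof (simp add: x that SUP_inf_le_iff inf_SUP_le_iff, intro ballI)
    fix y y' assume y: "y \<in> car G" and y': "y' \<in> car G"
    \<comment> \<open>The intermediate values \<open>y\<close> and \<open>y'\<close> come from the
      same \<open>x\<close>, hence are equal; moving \<open>\<sigma>\<close> from \<open>y\<close>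
      to \<open>y'\<close> reduces the claim to single-valuedness of \<open>\<sigma>\<close> at
      \<open>y'\<close>.\<close>
    have "inf (inf (truth \<sigma> z y) (truth \<theta> y x)) (inf (truth \<sigma> z' y') (truth \<theta> y' x))
        = inf (inf (truth \<sigma> z y) (inf (truth \<theta> y x) (truth \<theta> y' x))) (truth \<sigma> z' y')"
      by (simp add: inf.assoc inf.commute inf.left_commute)
    also have "\<dots> \<le> inf (inf (truth \<sigma> z y) (eqv G y y')) (truth \<sigma> z' y')"
      by (intro inf_mono order_refl rel_hom_single[OF \<theta> F G x y y'])
    also have "\<dots> \<le> inf (truth \<sigma> z y') (truth \<sigma> z' y')"
      by (intro inf_mono order_refl rel_hom_ext_left[OF \<sigma> G K y y' that(1)])
    also have "\<dots> \<le> eqv K z z'" by (rule rel_hom_single[OF \<sigma> G K y' that])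
    finally show "inf (inf (truth \<sigma> z y) (truth \<theta> y x)) (inf (truth \<sigma> z' y') (truth \<theta> y' x))
        \<le> eqv K z z'" .
  qed
qed

section \<open>Morphisms given by graphs of functions\<close>

definition graph :: "('h::complete_lattice, 'a) relsheaf \<Rightarrow> ('h, 'b) relsheaf \<Rightarrow> ('a \<Rightarrow> 'b)
    \<Rightarrow> ('h, 'a, 'b) relfam" where
  "graph F G f = of_truth (car F) (car G) (\<lambda>y x. eqv G y (f x))"

text \<open>Equality may grow off the diagonal, but extents are kept exactly: this is what makes the
  graph both strict and total.\<close>

definition rel_map :: "('h::complete_lattice, 'a) relsheaf \<Rightarrow> ('h, 'b) relsheaf \<Rightarrow> ('a \<Rightarrow> 'b) \<Rightarrow> bool"
  where "rel_map F G f \<longleftrightarrow> f \<in> car F \<rightarrow> car G \<and>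
    (\<forall>x\<in>car F. \<forall>x'\<in>car F. eqv F x x' \<le> eqv G (f x) (f x')) \<and>
    (\<forall>x\<in>car F. eqv G (f x) (f x) = eqv F x x)"

lemma graph_rel_hom:
  fixes F :: "('h::complete_heyting_algebra, 'a) relsheaf" and G :: "('h, 'b) relsheaf"
  assumes F: "is_relsheaf F" and G: "is_relsheaf G" and f: "rel_map F G f"
  shows "graph F G f \<in> rel_hom F G"
proof (rule rel_homI[OF F G])
  show "inf_family (car F) (car G) (graph F G f)" by (simp add: graph_def)
  note [simp] = graph_def
  fix x assume x: "x \<in> car F"
  then have fx: "f x \<in> car G" and eqx: "eqv F x x = eqv G (f x) (f x)"
    using f by (auto simp: rel_map_def)
  show "truth (graph F G f) y x \<le> eqv F x x" if "y \<in> car G" for y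
    using x fx that relsheaf_le_right[OF G] by (simp add: eqx)
  show "inf (truth (graph F G f) y x) (eqv F x x') \<le> truth (graph F G f) y x'"
    if x': "x' \<in> car F" and y: "y \<in> car G" for x' y
  proof -
    have "eqv F x x' \<le> eqv G (f x) (f x')" "f x' \<in> car G"
      using f x x' by (auto simp: rel_map_def)
    then have "inf (eqv G y (f x)) (eqv F x x') \<le> eqv G y (f x')"
      using relsheaf_trans[OF G y fx, of "f x'"] by (meson inf_mono order_refl order_trans)
    then show ?thesis using x x' y by simp
  qed
  show "inf (eqv G y' y) (truth (graph F G f) y x) \<le> truth (graph F G f) y' x"
    if "y \<in> car G" "y' \<in> car G" for y y'
    using x fx that relsheaf_trans[OF G] by simp
  show "eqv F x x \<le> (SUP y\<in>car G. truth (graph F G f) y x)"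
    using x fx by (auto simp: eqx intro: SUP_upper2)
  show "inf (truth (graph F G f) y x) (truth (graph F G f) y' x) \<le> eqv G y y'"
    if "y \<in> car G" "y' \<in> car G" for y y'
    using relsheaf_trans[OF G that(1) fx that(2)] x that relsheaf_sym[OF G, of "f x" y'] by simp
qed

text \<open>The supremum over intermediate elements is attained at \<open>y = f x\<close>; the other
  summands are bounded because \<open>g\<close> preserves equality and \<open>K\<close> is
  transitive.\<close>

lemma graph_comp:
  fixes F :: "('h::complete_heyting_algebra, 'a) relsheaf" and G :: "('h, 'b) relsheaf"
    and K :: "('h, 'c) relsheaf"
  assumes K: "is_relsheaf K" and f: "f \<in> car F \<rightarrow> car G" and g: "rel_map G K g"
  shows "fam_comp (car F) (car K) (graph G K g) (graph F G f) = graph F K (g \<circ> f)"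
proof (rule inf_family_eqI[of "car F" "car K"])
  have fam: "inf_family (car F) (car G) (graph F G f)" "inf_family (car G) (car K) (graph G K g)"
    by (simp_all add: graph_def)
  then show "inf_family (car F) (car K) (fam_comp (car F) (car K) (graph G K g) (graph F G f))"
    by (rule inf_family_fam_comp)
  show "inf_family (car F) (car K) (graph F K (g \<circ> f))" by (simp add: graph_def)
  fix x z assume x: "x \<in> car F" and z: "z \<in> car K"
  have fx: "f x \<in> car G" using f x by auto
  then have gfx: "g (f x) \<in> car K" using g by (auto simp: rel_map_def)
  have "(SUP y\<in>car G. inf (eqv K z (g y)) (eqv G y (f x))) = eqv K z (g (f x))"
  proof (rule order.antisym)
    show "(SUP y\<in>car G. inf (eqv K z (g y)) (eqv G y (f x))) \<le> eqv K z (g (f x))"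
    proof (rule SUP_least)
      fix y assume y: "y \<in> car G"
      then have gy: "g y \<in> car K" "eqv G y (f x) \<le> eqv K (g y) (g (f x))"
        using g fx by (auto simp: rel_map_def)
      then have "inf (eqv K z (g y)) (eqv G y (f x)) \<le> inf (eqv K z (g y)) (eqv K (g y) (g (f x)))"
        by (intro inf_mono order_refl)
      also have "\<dots> \<le> eqv K z (g (f x))" by (rule relsheaf_trans[OF K z gy(1) gfx])
      finally show "inf (eqv K z (g y)) (eqv G y (f x)) \<le> eqv K z (g (f x))" .
    qed
    \<comment> \<open>Exact preservation of extents makes the factor
      \<open>eqv G (f x) (f x)\<close> absorbed by the other one.\<close>
    have "eqv G (f x) (f x) = eqv K (g (f x)) (g (f x))"
      using g fx by (simp add: rel_map_def)
    then show "eqv K z (g (f x)) \<le> (SUP y\<in>car G. inf (eqv K z (g y)) (eqv G y (f x)))"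
      using relsheaf_le_right[OF K z gfx] by (intro SUP_upper2[OF fx]) simp
  qed
  then show "truth (fam_comp (car F) (car K) (graph G K g) (graph F G f)) z x
      = truth (graph F K (g \<circ> f)) z x"
    using x z fx by (simp add: truth_fam_comp[OF fam]) (simp add: graph_def)
qed

lemma graph_id: "is_relsheaf F \<Longrightarrow> graph F F (\<lambda>x. x) = rel F"
  by (rule inf_family_eqI[of "car F" "car F"]) (auto simp: graph_def relsheaf_inf_family)


section \<open>Presheaves as relational-sheaves\<close>

lemma presheafD:
  assumes "is_presheaf F"
  shows presheaf_rst: "k \<le> h \<Longrightarrow> x \<in> sec F h \<Longrightarrow> rst F h k x \<in> sec F k"
    and presheaf_rst_rst: "l \<le> k \<Longrightarrow> k \<le> h \<Longrightarrow> x \<in> sec F h \<Longrightarrow>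
      rst F k l (rst F h k x) = rst F h l x"
  using assms unfolding is_presheaf_def by blast+

lemma nt_homD:
  assumes "\<tau> \<in> nt_hom F G"
  shows nt_hom_extensional: "\<tau> h \<in> extensional (sec F h)"
    and nt_hom_sec: "x \<in> sec F h \<Longrightarrow> \<tau> h x \<in> sec G h"
    and nt_hom_rst: "k \<le> h \<Longrightarrow> x \<in> sec F h \<Longrightarrow> \<tau> k (rst F h k x) = rst G h k (\<tau> h x)"
  using assms unfolding nt_hom_def by (auto simp: PiE_def)

lemma nt_homI:
  assumes "\<And>h. \<tau> h \<in> extensional (sec F h)"
    and "\<And>h x. x \<in> sec F h \<Longrightarrow> \<tau> h x \<in> sec G h"
    and "\<And>h k x. k \<le> h \<Longrightarrow> x \<in> sec F h \<Longrightarrow> \<tau> k (rst F h k x) = rst G h k (\<tau> h x)"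
  shows "\<tau> \<in> nt_hom F G"
  using assms unfolding nt_hom_def by (auto simp: PiE_def)

lemma nt_hom_eqI:
  assumes "\<tau> \<in> nt_hom F G" "\<sigma> \<in> nt_hom F K"
    and "\<And>h x. x \<in> sec F h \<Longrightarrow> \<tau> h x = \<sigma> h x"
  shows "\<tau> = \<sigma>"
  using assms nt_hom_extensional by (intro ext[of \<tau>] extensionalityI) blast+

lemma nt_comp_apply [simp]: "x \<in> sec F h \<Longrightarrow> nt_comp F \<sigma> \<tau> h x = \<sigma> h (\<tau> h x)"
  by (simp add: nt_comp_def compose_def)

lemma nt_comp_hom:
  assumes F: "is_presheaf F" and "\<tau> \<in> nt_hom F G" "\<sigma> \<in> nt_hom G K"
  shows "nt_comp F \<sigma> \<tau> \<in> nt_hom F K"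
proof (rule nt_homI)
  show "nt_comp F \<sigma> \<tau> h \<in> extensional (sec F h)" for h by (simp add: nt_comp_def)
qed (use assms in \<open>simp_all add: nt_hom_sec nt_hom_rst presheaf_rst\<close>)

section \<open>Degree of agreement of local sections\<close>

text \<open>The matrix behind \<open>Delta_obj\<close>, and behind \<open>Delta_arr\<close> after
  applying the transformation. For a general presheaf the supremum need not be a level at which the
  two sections coincide.\<close>

definition agreement :: "('h::complete_lattice, 'a) presheaf \<Rightarrow> 'h \<times> 'a \<Rightarrow> 'h \<times> 'a \<Rightarrow> 'h" where
  "agreement F p q =
     Sup {m. m \<le> inf (fst p) (fst q) \<and> rst F (fst p) m (snd p) = rst F (fst q) m (snd q)}"

lemma mem_car_Delta [simp]: "p \<in> car (Delta_obj F) \<longleftrightarrow> snd p \<in> sec F (fst p)"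
  by (cases p) (simp add: Delta_obj_def)

lemma rel_Delta: "rel (Delta_obj F) = of_truth (car (Delta_obj F)) (car (Delta_obj F)) (agreement F)"
  by (auto simp: Delta_obj_def of_truth_def agreement_def fun_eq_iff inf.commute)

lemma eqv_Delta [simp]:
  "snd p \<in> sec F (fst p) \<Longrightarrow> snd q \<in> sec F (fst q) \<Longrightarrow> eqv (Delta_obj F) p q = agreement F p q"
  by (simp add: rel_Delta)

lemma agreement_sym: "agreement F p q = agreement F q p"
  unfolding agreement_def by (simp add: inf.commute eq_commute)

lemma agreement_self [simp]: "agreement F p p = fst p"
  by (auto simp: agreement_def intro!: Sup_eqI)

lemma agreement_le: "agreement F p q \<le> fst p" "agreement F p q \<le> fst q"
  by (auto simp: agreement_def intro!: Sup_least)

text \<open>By distributivity it suffices to take one level of agreement \<open>m\<close> for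
  \<open>p\<close>, \<open>q\<close> and one level \<open>n\<close> for \<open>q\<close>,
  \<open>r\<close>; on \<open>inf m n\<close> all three sections have the same restriction.\<close>

lemma agreement_trans:
  fixes F :: "('h::complete_heyting_algebra, 'a) presheaf"
  assumes F: "is_presheaf F"
    and p: "snd p \<in> sec F (fst p)" and q: "snd q \<in> sec F (fst q)" and r: "snd r \<in> sec F (fst r)"
  shows "inf (agreement F p q) (agreement F q r) \<le> agreement F p r"
proof (unfold agreement_def[of F p q] agreement_def[of F q r] Sup_inf_Sup_le_iff, clarify)
  fix m n
  assume mn: "m \<le> inf (fst p) (fst q)" "n \<le> inf (fst q) (fst r)"
    and m: "rst F (fst p) m (snd p) = rst F (fst q) m (snd q)"
    and n: "rst F (fst q) n (snd q) = rst F (fst r) n (snd r)"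
  have le: "m \<le> fst p" "m \<le> fst q" "n \<le> fst q" "n \<le> fst r" using mn by auto
  have "rst F (fst p) (inf m n) (snd p) = rst F m (inf m n) (rst F (fst p) m (snd p))"
    using presheaf_rst_rst[OF F _ le(1) p, of "inf m n"] by simp
  also have "\<dots> = rst F (fst q) (inf m n) (snd q)"
    using presheaf_rst_rst[OF F _ le(2) q, of "inf m n"] m by simp
  also have "\<dots> = rst F n (inf m n) (rst F (fst q) n (snd q))"
    using presheaf_rst_rst[OF F _ le(3) q, of "inf m n"] by simp
  also have "\<dots> = rst F (fst r) (inf m n) (snd r)"
    using presheaf_rst_rst[OF F _ le(4) r, of "inf m n"] n by simp
  finally show "inf m n \<le> agreement F p r"
    using le unfolding agreement_def by (intro Sup_upper) (auto intro: le_infI1 le_infI2)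
qed

lemma relsheaf_Delta:
  fixes F :: "('h::complete_heyting_algebra, 'a) presheaf"
  assumes "is_presheaf F"
  shows "is_relsheaf (Delta_obj F)"
proof (rule relsheafI)
  show "inf_family (car (Delta_obj F)) (car (Delta_obj F)) (rel (Delta_obj F))"
    by (simp add: rel_Delta)
qed (use agreement_sym agreement_trans[OF assms] in auto)

text \<open>Restricting a section cuts its column of agreements down by \<open>k\<close>. This is
  what makes the unit natural.\<close>

lemma agreement_rst:
  fixes F :: "('h::complete_heyting_algebra, 'a) presheaf"
  assumes F: "is_presheaf F" and p: "snd p \<in> sec F (fst p)" and x: "x \<in> sec F h" and kh: "k \<le> h"
  shows "agreement F p (k, rst F h k x) = inf (agreement F p (h, x)) k"
proof (rule order.antisym)
  have "agreement F p (k, rst F h k x) \<le> agreement F p (h, x)"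
    unfolding agreement_def
    by (rule Sup_subset_mono)
      (auto simp: presheaf_rst_rst[OF F _ kh x] intro: order_trans[OF _ kh])
  then show "agreement F p (k, rst F h k x) \<le> inf (agreement F p (h, x)) k"
    using agreement_le(2)[of F p "(k, rst F h k x)"] by simp
  \<comment> \<open>A level of agreement with \<open>x\<close>, once cut down to
    \<open>inf k m\<close>, is a level of agreement with the restriction of \<open>x\<close>;
    distributivity then collects these levels.\<close>
  have "inf k m \<le> agreement F p (k, rst F h k x)"
    if m: "m \<le> fst p" "m \<le> h" "rst F (fst p) m (snd p) = rst F h m x" for m
  proof -
    have "rst F (fst p) (inf k m) (snd p) = rst F h (inf k m) x"
      using presheaf_rst_rst[OF F _ m(1) p, of "inf k m"] presheaf_rst_rst[OF F _ m(2) x, of "inf k m"]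
        m(3) by simp
    then show ?thesis
      using m kh unfolding agreement_def
      by (intro Sup_upper) (auto simp: presheaf_rst_rst[OF F _ kh x] le_infI2)
  qed
  then have "inf k (agreement F p (h, x)) \<le> agreement F p (k, rst F h k x)"
    unfolding agreement_def[of F p "(h, x)"] inf_Sup_distrib by (auto intro!: SUP_least)
  then show "inf (agreement F p (h, x)) k \<le> agreement F p (k, rst F h k x)"
    by (simp add: inf.commute)
qed

section \<open>Natural transformations as graphs\<close>

definition nt_pair :: "('h, 'a, 'b) nat_trans \<Rightarrow> 'h \<times> 'a \<Rightarrow> 'h \<times> 'b" where
  "nt_pair \<tau> p = (fst p, \<tau> (fst p) (snd p))"

text \<open>Reduces functoriality of \<Delta> to \<open>graph_id\<close> and
  \<open>graph_comp\<close>.\<close>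

lemma Delta_arr_eq_graph:
  assumes "\<tau> \<in> nt_hom F G"
  shows "Delta_arr F G \<tau> = graph (Delta_obj F) (Delta_obj G) (nt_pair \<tau>)"
  using nt_hom_sec[OF assms]
  by (auto simp: Delta_arr_def graph_def of_truth_def agreement_def nt_pair_def fun_eq_iff
      inf.commute)

text \<open>Naturality sends a level of agreement to a level of agreement, and
  \<open>nt_pair\<close> keeps the first component, which is the extent.\<close>

lemma rel_map_nt_pair:
  assumes \<tau>: "\<tau> \<in> nt_hom F G"
  shows "rel_map (Delta_obj F) (Delta_obj G) (nt_pair \<tau>)"
proof -
  have "agreement F p q \<le> agreement G (nt_pair \<tau> p) (nt_pair \<tau> q)"
    if p: "snd p \<in> sec F (fst p)" and q: "snd q \<in> sec F (fst q)" for p q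
    unfolding agreement_def
  proof (rule Sup_subset_mono, clarify)
    fix m assume m: "m \<le> inf (fst p) (fst q)" "rst F (fst p) m (snd p) = rst F (fst q) m (snd q)"
    then show "m \<le> inf (fst (nt_pair \<tau> p)) (fst (nt_pair \<tau> q)) \<and>
        rst G (fst (nt_pair \<tau> p)) m (snd (nt_pair \<tau> p)) =
        rst G (fst (nt_pair \<tau> q)) m (snd (nt_pair \<tau> q))"
      using nt_hom_rst[OF \<tau> _ p, of m] nt_hom_rst[OF \<tau> _ q, of m] by (simp add: nt_pair_def)
  qed
  then show ?thesis
    using nt_hom_sec[OF \<tau>] by (simp add: rel_map_def) (auto simp: nt_pair_def)
qed

lemma Delta_arr_rel_hom:
  fixes F :: "('h::complete_heyting_algebra, 'a) presheaf" and G :: "('h, 'b) presheaf"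
  assumes "is_presheaf F" "is_presheaf G" "\<tau> \<in> nt_hom F G"
  shows "Delta_arr F G \<tau> \<in> rel_hom (Delta_obj F) (Delta_obj G)"
  using assms by (simp add: Delta_arr_eq_graph graph_rel_hom relsheaf_Delta rel_map_nt_pair)

lemma graph_cong:
  assumes "\<And>x. x \<in> car F \<Longrightarrow> f x = g x"
  shows "graph F G f = graph F G g"
  using assms by (auto simp: graph_def of_truth_def fun_eq_iff)

lemma nt_id_hom:
  assumes "is_presheaf F"
  shows "(\<lambda>h. \<lambda>x\<in>sec F h. x) \<in> nt_hom F F"
  by (rule nt_homI) (simp_all add: presheaf_rst[OF assms])

lemma Delta_arr_id:
  fixes F :: "('h::complete_heyting_algebra, 'a) presheaf"
  assumes "is_presheaf F"
  shows "Delta_arr F F (\<lambda>h. \<lambda>x\<in>sec F h. x) = rel (Delta_obj F)"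
  unfolding Delta_arr_eq_graph[OF nt_id_hom[OF assms]] graph_id[OF relsheaf_Delta[OF assms], symmetric]
  by (rule graph_cong) (simp add: nt_pair_def)

lemma Delta_arr_comp:
  fixes F :: "('h::complete_heyting_algebra, 'a) presheaf" and G :: "('h, 'b) presheaf"
    and K :: "('h, 'c) presheaf"
  assumes "is_presheaf F" "is_presheaf G" "is_presheaf K" "\<tau> \<in> nt_hom F G" "\<sigma> \<in> nt_hom G K"
  shows "Delta_arr F K (nt_comp F \<sigma> \<tau>) =
    fam_comp (car (Delta_obj F)) (car (Delta_obj K)) (Delta_arr G K \<sigma>) (Delta_arr F G \<tau>)"
proof -
  have "nt_pair \<tau> \<in> car (Delta_obj F) \<rightarrow> car (Delta_obj G)"
    using rel_map_nt_pair[OF assms(4)] by (simp add: rel_map_def)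
  then show ?thesis
    using assms
    by (simp add: Delta_arr_eq_graph nt_comp_hom graph_comp relsheaf_Delta rel_map_nt_pair)
      (rule graph_cong, simp add: nt_pair_def)
qed


section \<open>Sections of a relational-sheaf\<close>

lemma car_singleton [simp]: "car (singleton_relsheaf h) = {()}"
  by (simp add: singleton_relsheaf_def)

lemma rel_singleton: "rel (singleton_relsheaf h) = singleton_incl h"
  by (simp add: singleton_relsheaf_def singleton_incl_def fun_eq_iff)

lemma singleton_incl_eq_of_truth: "singleton_incl k = of_truth {()} {()} (\<lambda>_ _. k)"
  by (auto simp: singleton_incl_def of_truth_def fun_eq_iff)

lemma truth_singleton_incl [simp]: "truth (singleton_incl k) u v = k"
  by (simp add: singleton_incl_eq_of_truth)

lemma eqv_singleton [simp]: "eqv (singleton_relsheaf h) u v = h"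
  by (simp add: rel_singleton)

lemma relsheaf_singleton: "is_relsheaf (singleton_relsheaf h)"
  by (rule relsheafI) (simp_all add: rel_singleton singleton_incl_eq_of_truth)

lemma singleton_incl_rel_hom:
  fixes h :: "'h::complete_heyting_algebra"
  assumes "k \<le> h"
  shows "singleton_incl k \<in> rel_hom (singleton_relsheaf k) (singleton_relsheaf h)"
  by (rule rel_homI[OF relsheaf_singleton relsheaf_singleton])
    (use assms in \<open>simp_all add: singleton_incl_eq_of_truth[of k] le_infI2\<close>)

section \<open>Sections over \<open>h\<close> as columns of truth values, and their gluing\<close>

context
  fixes G :: "('h::complete_heyting_algebra, 'a) relsheaf"
  assumes G: "is_relsheaf G"
begin

lemma sec_Theta: "sec (Theta_obj G) h = rel_hom (singleton_relsheaf h) G"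
  by (simp add: Theta_obj_def)

text \<open>A morphism out of a singleton is a matrix with one column. Strictness and totality
  together say that the column has supremum exactly \<open>h\<close>.\<close>

lemma sec_ThetaI:
  assumes fam: "inf_family {()} (car G) \<alpha>"
    and ext: "\<And>x y. x \<in> car G \<Longrightarrow> y \<in> car G \<Longrightarrow> inf (eqv G y x) (truth \<alpha> x ()) \<le> truth \<alpha> y ()"
    and single: "\<And>x y. x \<in> car G \<Longrightarrow> y \<in> car G \<Longrightarrow> inf (truth \<alpha> x ()) (truth \<alpha> y ()) \<le> eqv G x y"
    and total: "(SUP x\<in>car G. truth \<alpha> x ()) = h"
  shows "\<alpha> \<in> sec (Theta_obj G) h"
  unfolding sec_Theta
proof (rule rel_homI[OF relsheaf_singleton G])
  show "truth \<alpha> y x \<le> eqv (singleton_relsheaf h) x x" if "y \<in> car G" for x y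
    using SUP_upper[OF that, of "\<lambda>x. truth \<alpha> x ()"] total by simp
qed (use assms in \<open>simp_all add: le_infI1\<close>)

lemma sec_ThetaD:
  assumes \<alpha>: "\<alpha> \<in> sec (Theta_obj G) h"
  shows sec_Theta_inf_family: "inf_family {()} (car G) \<alpha>"
    and sec_Theta_ext: "x \<in> car G \<Longrightarrow> y \<in> car G \<Longrightarrow> inf (eqv G y x) (truth \<alpha> x ()) \<le> truth \<alpha> y ()"
    and sec_Theta_single: "x \<in> car G \<Longrightarrow> y \<in> car G \<Longrightarrow> inf (truth \<alpha> x ()) (truth \<alpha> y ()) \<le> eqv G x y"
    and sec_Theta_total: "(SUP x\<in>car G. truth \<alpha> x ()) = h"
    and sec_Theta_le: "x \<in> car G \<Longrightarrow> truth \<alpha> x () \<le> h"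
proof -
  note hom = \<alpha>[unfolded sec_Theta] and S = relsheaf_singleton
  show "inf_family {()} (car G) \<alpha>" using rel_hom_inf_family[OF hom S G] by simp
  show "inf (eqv G y x) (truth \<alpha> x ()) \<le> truth \<alpha> y ()" if "x \<in> car G" "y \<in> car G" for x y
    using rel_hom_ext_right[OF hom S G, of "()"] that by simp
  show "inf (truth \<alpha> x ()) (truth \<alpha> y ()) \<le> eqv G x y" if "x \<in> car G" "y \<in> car G" for x y
    using rel_hom_single[OF hom S G, of "()"] that by simp
  show le: "truth \<alpha> x () \<le> h" if "x \<in> car G" for x
    using rel_hom_strict[OF hom S G, of "()" x] that by simp
  show "(SUP x\<in>car G. truth \<alpha> x ()) = h"
    using rel_hom_total[OF hom S G, of "()"] le by (auto intro: order.antisym SUP_least)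
qed

lemma sec_Theta_eqI:
  assumes "\<alpha> \<in> sec (Theta_obj G) h" "\<beta> \<in> sec (Theta_obj G) k"
    and "\<And>x. x \<in> car G \<Longrightarrow> truth \<alpha> x () = truth \<beta> x ()"
  shows "\<alpha> = \<beta>"
  using assms sec_Theta_inf_family by (intro inf_family_eqI[of "{()}" "car G"]) auto

text \<open>Restriction multiplies the column by a matrix with the single entry
  \<open>k\<close>.\<close>

lemma truth_rst_Theta:
  assumes "\<alpha> \<in> sec (Theta_obj G) h" "x \<in> car G"
  shows "truth (rst (Theta_obj G) h k \<alpha>) x () = inf (truth \<alpha> x ()) k"
  using truth_fam_comp[of "{()}" "{()}" "singleton_incl k" "car G" \<alpha> "()" x]
    sec_Theta_inf_family[OF assms(1)] assms(2)
  by (simp add: Theta_obj_def singleton_incl_eq_of_truth)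

lemma presheaf_Theta: "is_presheaf (Theta_obj G)"
proof -
  have rst: "rst (Theta_obj G) h k \<alpha> \<in> sec (Theta_obj G) k"
    if "k \<le> h" "\<alpha> \<in> sec (Theta_obj G) h" for h k \<alpha>
    using rel_hom_comp[OF relsheaf_singleton relsheaf_singleton G singleton_incl_rel_hom[OF that(1)]]
      that(2) by (simp add: Theta_obj_def)
  moreover have "rst (Theta_obj G) h h \<alpha> = \<alpha>" if \<alpha>: "\<alpha> \<in> sec (Theta_obj G) h" for h \<alpha>
    by (rule sec_Theta_eqI[OF rst[OF order_refl \<alpha>] \<alpha>])
      (simp add: truth_rst_Theta[OF \<alpha>] sec_Theta_le[OF \<alpha>] inf.absorb1)
  moreover have "rst (Theta_obj G) k l (rst (Theta_obj G) h k \<alpha>) = rst (Theta_obj G) h l \<alpha>"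
    if "l \<le> k" "k \<le> h" and \<alpha>: "\<alpha> \<in> sec (Theta_obj G) h" for h k l \<alpha>
    by (rule sec_Theta_eqI[OF rst[OF that(1) rst[OF that(2) \<alpha>]] rst[OF order_trans[OF that(1,2)] \<alpha>]])
      (simp add: truth_rst_Theta[OF rst[OF that(2) \<alpha>]] truth_rst_Theta[OF \<alpha>] inf.assoc
        inf.absorb2[OF that(1)])
  ultimately show ?thesis by (auto simp: is_presheaf_def)
qed

text \<open>Every entry lies below \<open>Sup A\<close>, so distributivity recovers it from its cuts
  at the members of \<open>A\<close>.\<close>

lemma amalgamation_Theta_unique:
  assumes "amalgamation (Theta_obj G) A x \<alpha>" "amalgamation (Theta_obj G) A x \<beta>"
  shows "\<alpha> = \<beta>"
proof -
  have rst: "rst (Theta_obj G) (Sup A) k \<alpha> = rst (Theta_obj G) (Sup A) k \<beta>" if "k \<in> A" for k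
    using assms that by (auto simp: amalgamation_def)
  show ?thesis
  proof (rule sec_Theta_eqI)
    show \<alpha>: "\<alpha> \<in> sec (Theta_obj G) (Sup A)" and \<beta>: "\<beta> \<in> sec (Theta_obj G) (Sup A)"
      using assms by (auto simp: amalgamation_def)
    fix y assume y: "y \<in> car G"
    have "truth \<alpha> y () = inf (truth \<alpha> y ()) (Sup A)"
      using sec_Theta_le[OF \<alpha> y] by (simp add: inf.absorb1)
    also have "\<dots> = (SUP k\<in>A. inf (truth \<alpha> y ()) k)" by (rule inf_Sup_distrib)
    also have "\<dots> = (SUP k\<in>A. inf (truth \<beta> y ()) k)"
      using rst by (intro SUP_cong refl) (metis truth_rst_Theta[OF \<alpha> y] truth_rst_Theta[OF \<beta> y])
    also have "\<dots> = inf (truth \<beta> y ()) (Sup A)" by (rule inf_Sup_distrib[symmetric])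
    also have "\<dots> = truth \<beta> y ()"
      using sec_Theta_le[OF \<beta> y] by (simp add: inf.absorb1)
    finally show "truth \<alpha> y () = truth \<beta> y ()" .
  qed
qed

text \<open>Sections are glued by taking the supremum of their columns entry by entry; the matching
  condition keeps the result single-valued.\<close>

lemma sheaf_Theta: "is_sheaf (Theta_obj G)"
  unfolding is_sheaf_def
proof (intro conjI allI impI)
  show "is_presheaf (Theta_obj G)" by (rule presheaf_Theta)
  fix A x assume match: "matching_family (Theta_obj G) A x"
  then have x: "x k \<in> sec (Theta_obj G) k" if "k \<in> A" for k
    using that by (simp add: matching_family_def)
  have agree: "inf (truth (x k) y ()) l = inf (truth (x l) y ()) k"
    if k: "k \<in> A" and l: "l \<in> A" and y: "y \<in> car G" for k l y
  proof -
    have "rst (Theta_obj G) k (inf k l) (x k) = rst (Theta_obj G) l (inf k l) (x l)"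
      using match k l unfolding matching_family_def by blast
    then have "inf (truth (x k) y ()) (inf k l) = inf (truth (x l) y ()) (inf k l)"
      by (simp add: truth_rst_Theta[OF x[OF k] y, symmetric] truth_rst_Theta[OF x[OF l] y, symmetric])
    \<comment> \<open>Entries of \<open>x k\<close> already lie below \<open>k\<close>, so cutting
      by \<open>inf k l\<close> is the same as cutting by \<open>l\<close>.\<close>
    moreover have "inf (truth (x k) y ()) (inf k l) = inf (truth (x k) y ()) l"
      using sec_Theta_le[OF x[OF k] y] by (simp add: inf.assoc[symmetric] inf.absorb1)
    moreover have "inf (truth (x l) y ()) (inf k l) = inf (truth (x l) y ()) k"
      using sec_Theta_le[OF x[OF l] y]
      by (simp add: inf.commute[of k l] inf.assoc[symmetric] inf.absorb1)
    ultimately show ?thesis by simp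
  qed
  define \<alpha> where "\<alpha> = of_truth {()} (car G) (\<lambda>y _. SUP k\<in>A. truth (x k) y ())"
  have truth_\<alpha> [simp]: "truth \<alpha> y () = (SUP k\<in>A. truth (x k) y ())" if "y \<in> car G" for y
    using that by (simp add: \<alpha>_def)
  have sec: "\<alpha> \<in> sec (Theta_obj G) (Sup A)"
  proof (rule sec_ThetaI)
    show "inf_family {()} (car G) \<alpha>" by (simp add: \<alpha>_def)
    show "inf (eqv G z y) (truth \<alpha> y ()) \<le> truth \<alpha> z ()" if "y \<in> car G" "z \<in> car G" for y z
      using that sec_Theta_ext[OF x] by (auto simp: inf_SUP_le_iff intro: SUP_upper2)
    show "inf (truth \<alpha> y ()) (truth \<alpha> z ()) \<le> eqv G y z" if y: "y \<in> car G" and z: "z \<in> car G" for y z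
    proof (simp add: y z SUP_inf_le_iff inf_SUP_le_iff, intro ballI)
      fix k l assume k: "k \<in> A" and l: "l \<in> A"
      \<comment> \<open>The entry of \<open>x l\<close> lies below \<open>l\<close>, where
        \<open>x k\<close> agrees with \<open>x l\<close>; this brings both factors into the one
        section \<open>x l\<close>.\<close>
      have "inf (truth (x k) y ()) (truth (x l) z ()) \<le> inf (truth (x k) y ()) l"
        using sec_Theta_le[OF x[OF l] z] by (simp add: le_infI2)
      also have "\<dots> \<le> truth (x l) y ()" by (simp add: agree[OF k l y])
      finally have "inf (truth (x k) y ()) (truth (x l) z ())
          \<le> inf (truth (x l) y ()) (truth (x l) z ())" by simp
      also have "\<dots> \<le> eqv G y z" by (rule sec_Theta_single[OF x[OF l] y z])
      finally show "inf (truth (x k) y ()) (truth (x l) z ()) \<le> eqv G y z" .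
    qed
    have "(SUP y\<in>car G. truth \<alpha> y ()) = (SUP y\<in>car G. SUP k\<in>A. truth (x k) y ())"
      by (rule SUP_cong) simp_all
    also have "\<dots> = (SUP k\<in>A. SUP y\<in>car G. truth (x k) y ())" by (rule SUP_commute)
    also have "\<dots> = (SUP k\<in>A. k)" by (rule SUP_cong) (simp_all add: sec_Theta_total[OF x])
    finally show "(SUP y\<in>car G. truth \<alpha> y ()) = Sup A" by simp
  qed
  have "amalgamation (Theta_obj G) A x \<alpha>"
    unfolding amalgamation_def
  proof (intro conjI ballI sec)
    fix k assume k: "k \<in> A"
    show "rst (Theta_obj G) (Sup A) k \<alpha> = x k"
    proof (rule sec_Theta_eqI[OF presheaf_rst[OF presheaf_Theta Sup_upper[OF k] sec] x[OF k]])
      fix y assume y: "y \<in> car G"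
      \<comment> \<open>After cutting by \<open>k\<close>, the other sections contribute no more
        than \<open>x k\<close> does.\<close>
      have "inf (SUP l\<in>A. truth (x l) y ()) k = truth (x k) y ()"
      proof (rule order.antisym)
        show "inf (SUP l\<in>A. truth (x l) y ()) k \<le> truth (x k) y ()"
          unfolding SUP_inf_le_iff using agree[OF _ k y] by simp
        show "truth (x k) y () \<le> inf (SUP l\<in>A. truth (x l) y ()) k"
          using k sec_Theta_le[OF x[OF k] y] by (intro le_infI SUP_upper2[OF k]) simp_all
      qed
      then show "truth (rst (Theta_obj G) (Sup A) k \<alpha>) y () = truth (x k) y ()"
        using y by (simp add: truth_rst_Theta[OF sec])
    qed
  qed
  then show "\<exists>!\<alpha>. amalgamation (Theta_obj G) A x \<alpha>"
    using amalgamation_Theta_unique by blast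
qed

end

section \<open>Functoriality of postcomposition\<close>

lemma Theta_arr_hom:
  fixes F :: "('h::complete_heyting_algebra, 'a) relsheaf" and G :: "('h, 'b) relsheaf"
  assumes F: "is_relsheaf F" and G: "is_relsheaf G" and \<tau>: "\<tau> \<in> rel_hom F G"
  shows "Theta_arr F G \<tau> \<in> nt_hom (Theta_obj F) (Theta_obj G)"
proof (rule nt_homI)
  fix h
  show "Theta_arr F G \<tau> h \<in> extensional (sec (Theta_obj F) h)"
    by (simp add: Theta_arr_def Theta_obj_def)
  fix \<alpha> assume \<alpha>: "\<alpha> \<in> sec (Theta_obj F) h"
  show "Theta_arr F G \<tau> h \<alpha> \<in> sec (Theta_obj G) h"
    using rel_hom_comp[OF relsheaf_singleton F G _ \<tau>] \<alpha> by (simp add: Theta_arr_def Theta_obj_def)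
  fix k assume "k \<le> h"
  then have "rst (Theta_obj F) h k \<alpha> \<in> sec (Theta_obj F) k"
    using presheaf_rst[OF presheaf_Theta[OF F]] \<alpha> by blast
  \<comment> \<open>Restriction is precomposition and \<open>Theta_arr\<close> is postcomposition,
    so naturality is associativity.\<close>
  then show "Theta_arr F G \<tau> k (rst (Theta_obj F) h k \<alpha>) = rst (Theta_obj G) h k (Theta_arr F G \<tau> h \<alpha>)"
    using \<alpha> fam_comp_assoc[of "{()}" "{()}" "singleton_incl k" "car F" \<alpha> "car G" \<tau>]
      sec_Theta_inf_family[OF F \<alpha>] rel_hom_inf_family[OF \<tau> F G]
    by (simp add: Theta_arr_def Theta_obj_def singleton_incl_eq_of_truth)
qed

lemma Theta_arr_id:
  fixes F :: "('h::complete_heyting_algebra, 'a) relsheaf"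
  shows "Theta_arr F F (rel F) = (\<lambda>h. \<lambda>\<alpha>\<in>sec (Theta_obj F) h. \<alpha>)"
  by (rule ext) (auto simp: Theta_arr_def Theta_obj_def rel_hom_def intro!: restrict_ext)

lemma Theta_arr_comp:
  fixes F :: "('h::complete_heyting_algebra, 'a) relsheaf" and G :: "('h, 'b) relsheaf"
    and K :: "('h, 'c) relsheaf"
  assumes F: "is_relsheaf F" and G: "is_relsheaf G" and K: "is_relsheaf K"
    and \<tau>: "\<tau> \<in> rel_hom F G" and \<sigma>: "\<sigma> \<in> rel_hom G K"
  shows "Theta_arr F K (fam_comp (car F) (car K) \<sigma> \<tau>) =
    nt_comp (Theta_obj F) (Theta_arr G K \<sigma>) (Theta_arr F G \<tau>)"
proof (rule nt_hom_eqI)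
  note hom = Theta_arr_hom[OF F G \<tau>] and \<sigma>\<tau> = rel_hom_comp[OF F G K \<tau> \<sigma>]
  show "Theta_arr F K (fam_comp (car F) (car K) \<sigma> \<tau>) \<in> nt_hom (Theta_obj F) (Theta_obj K)"
    by (rule Theta_arr_hom[OF F K \<sigma>\<tau>])
  show "nt_comp (Theta_obj F) (Theta_arr G K \<sigma>) (Theta_arr F G \<tau>) \<in> nt_hom (Theta_obj F) (Theta_obj K)"
    by (rule nt_comp_hom[OF presheaf_Theta[OF F] hom Theta_arr_hom[OF G K \<sigma>]])
  fix h \<alpha> assume \<alpha>: "\<alpha> \<in> sec (Theta_obj F) h"
  then show "Theta_arr F K (fam_comp (car F) (car K) \<sigma> \<tau>) h \<alpha> =
      nt_comp (Theta_obj F) (Theta_arr G K \<sigma>) (Theta_arr F G \<tau>) h \<alpha>"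
    using nt_hom_sec[OF hom \<alpha>]
      fam_comp_assoc[OF sec_Theta_inf_family[OF F \<alpha>] rel_hom_inf_family[OF \<tau> F G]
        rel_hom_inf_family[OF \<sigma> G K]]
    by (simp add: Theta_arr_def Theta_obj_def)
qed


section \<open>The unit of sheafification\<close>

abbreviation TD :: "('h::complete_lattice, 'a) presheaf \<Rightarrow> ('h, ('h, unit, 'h \<times> 'a) relfam) presheaf"
  where "TD F \<equiv> Theta_obj (Delta_obj F)"

text \<open>The one point of the singleton is sent to \<open>(h, x)\<close>; the resulting column
  lists the agreement of every local section with \<open>x\<close>.\<close>

definition unit_nt :: "('h::complete_lattice, 'a) presheaf
    \<Rightarrow> ('h, 'a, ('h, unit, 'h \<times> 'a) relfam) nat_trans" where
  "unit_nt F = (\<lambda>h. \<lambda>x\<in>sec F h. graph (singleton_relsheaf h) (Delta_obj F) (\<lambda>_. (h, x)))"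

lemma sheaf_presheaf: "is_sheaf F \<Longrightarrow> is_presheaf F"
  by (simp add: is_sheaf_def)

text \<open>Both sections amalgamate the restrictions of \<open>x\<close>. This separation property
  is applied below to covers by truth values.\<close>

lemma sheaf_eqI:
  assumes F: "is_sheaf F" and x: "x \<in> sec F (Sup A)" and y: "y \<in> sec F (Sup A)"
    and eq: "\<And>k. k \<in> A \<Longrightarrow> rst F (Sup A) k x = rst F (Sup A) k y"
  shows "x = y"
proof -
  note P = sheaf_presheaf[OF F]
  have "matching_family F A (\<lambda>k. rst F (Sup A) k x)"
    using presheaf_rst[OF P Sup_upper x] presheaf_rst_rst[OF P _ Sup_upper x]
    by (simp add: matching_family_def)
  then have "\<exists>!s. amalgamation F A (\<lambda>k. rst F (Sup A) k x) s"
    using F by (simp add: is_sheaf_def)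
  moreover have "amalgamation F A (\<lambda>k. rst F (Sup A) k x) x"
    "amalgamation F A (\<lambda>k. rst F (Sup A) k x) y"
    using x y eq by (simp_all add: amalgamation_def)
  ultimately show ?thesis by blast
qed

section \<open>The unit for an arbitrary presheaf\<close>

context
  fixes F :: "('h::complete_heyting_algebra, 'a) presheaf"
  assumes F: "is_presheaf F"
begin

lemma truth_unit_nt:
  "x \<in> sec F h \<Longrightarrow> snd p \<in> sec F (fst p) \<Longrightarrow> truth (unit_nt F h x) p () = agreement F p (h, x)"
  by (simp add: unit_nt_def graph_def)

lemma unit_nt_sec: "x \<in> sec F h \<Longrightarrow> unit_nt F h x \<in> sec (TD F) h"
  by (simp add: unit_nt_def Theta_obj_def graph_rel_hom relsheaf_singleton relsheaf_Delta[OF F] rel_map_def)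

lemma unit_nt_hom: "unit_nt F \<in> nt_hom F (TD F)"
proof (rule nt_homI)
  fix h k x assume kh: "k \<le> h" and x: "x \<in> sec F h"
  note y = presheaf_rst[OF F kh x] and \<alpha> = unit_nt_sec[OF x]
  show "unit_nt F k (rst F h k x) = rst (TD F) h k (unit_nt F h x)"
    by (rule sec_Theta_eqI[OF relsheaf_Delta[OF F] unit_nt_sec[OF y] presheaf_rst[OF presheaf_Theta[OF relsheaf_Delta[OF F]] kh \<alpha>]])
      (simp add: truth_unit_nt x y truth_rst_Theta[OF relsheaf_Delta[OF F] \<alpha>] agreement_rst[OF F _ x kh])
qed (simp_all add: unit_nt_sec, simp add: unit_nt_def)

lemma unit_nt_locally_surj:
  assumes \<alpha>: "\<alpha> \<in> sec (TD F) h" and p: "snd p \<in> sec F (fst p)"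
  defines "k \<equiv> truth \<alpha> p ()"
  shows "k \<le> fst p" and "rst (TD F) h k \<alpha> = unit_nt F k (rst F (fst p) k (snd p))"
proof -
  have "k \<le> eqv (Delta_obj F) p p"
    using sec_Theta_single[OF relsheaf_Delta[OF F] \<alpha>, of p p] p by (simp add: k_def)
  then show kp: "k \<le> fst p" using p by simp
  have kh: "k \<le> h" using sec_Theta_le[OF relsheaf_Delta[OF F] \<alpha>, of p] p by (simp add: k_def)
  note x = presheaf_rst[OF F kp p]
  show "rst (TD F) h k \<alpha> = unit_nt F k (rst F (fst p) k (snd p))"
  proof (rule sec_Theta_eqI[OF relsheaf_Delta[OF F] presheaf_rst[OF presheaf_Theta[OF relsheaf_Delta[OF F]] kh \<alpha>] unit_nt_sec[OF x]])
    fix q assume "q \<in> car (Delta_obj F)"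
    then have q: "snd q \<in> sec F (fst q)" by simp
    \<comment> \<open>One inequality is single-valuedness of \<alpha>; the other is extensionality,
      which transports the value \<open>k\<close> at \<open>p\<close> along the agreement of
      \<open>q\<close> with \<open>p\<close>.\<close>
    have "inf (truth \<alpha> q ()) k = inf (agreement F q p) k"
      using sec_Theta_single[OF relsheaf_Delta[OF F] \<alpha>, of q p] sec_Theta_ext[OF relsheaf_Delta[OF F] \<alpha>, of p q] p q
      by (intro order.antisym) (simp_all add: k_def)
    then show "truth (rst (TD F) h k \<alpha>) q () = truth (unit_nt F k (rst F (fst p) k (snd p))) q ()"
      using q p by (simp add: truth_rst_Theta[OF relsheaf_Delta[OF F] \<alpha>] truth_unit_nt[OF x] agreement_rst[OF F _ _ kp])
  qed
qed

lemma Sup_truth_section: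
  assumes \<alpha>: "\<alpha> \<in> sec (TD F) h"
  shows "Sup ((\<lambda>p. truth \<alpha> p ()) ` car (Delta_obj F)) = h"
  using sec_Theta_total[OF relsheaf_Delta[OF F] \<alpha>] by simp

text \<open>The truth values of a section cover its domain, and on each of them the section is in
  the image of the unit. Naturality moves the comparison there, and the sheaf \<open>G\<close> is
  separated.\<close>

lemma nt_hom_TD_eqI:
  assumes G: "is_sheaf G" and f: "f \<in> nt_hom (TD F) G" and g: "g \<in> nt_hom (TD F) G"
    and eq: "\<And>h x. x \<in> sec F h \<Longrightarrow> f h (unit_nt F h x) = g h (unit_nt F h x)"
  shows "f = g"
proof (rule nt_hom_eqI[OF f g])
  fix h \<alpha> assume \<alpha>: "\<alpha> \<in> sec (TD F) h"
  let ?A = "(\<lambda>p. truth \<alpha> p ()) ` car (Delta_obj F)"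
  have h: "Sup ?A = h" by (rule Sup_truth_section[OF \<alpha>])
  have "rst G h k (f h \<alpha>) = rst G h k (g h \<alpha>)" if "k \<in> ?A" for k
  proof -
    from that obtain p where p: "snd p \<in> sec F (fst p)" and k: "k = truth \<alpha> p ()" by auto
    have "k \<le> h" using Sup_upper[OF that] unfolding h .
    then have "rst G h k (f h \<alpha>) = f k (rst (TD F) h k \<alpha>)" "rst G h k (g h \<alpha>) = g k (rst (TD F) h k \<alpha>)"
      using nt_hom_rst[OF f _ \<alpha>] nt_hom_rst[OF g _ \<alpha>] by simp_all
    then show ?thesis
      using unit_nt_locally_surj[OF \<alpha> p] eq presheaf_rst[OF F _ p] by (simp add: k)
  qed
  then show "f h \<alpha> = g h \<alpha>"
    using sheaf_eqI[OF G, of "f h \<alpha>" ?A "g h \<alpha>"] nt_hom_sec[OF f \<alpha>] nt_hom_sec[OF g \<alpha>] h by simp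
qed

end

text \<open>Both sides are graphs of the same map out of the one-point set, by
  \<open>graph_comp\<close>.\<close>

lemma unit_nt_natural:
  fixes F :: "('h::complete_heyting_algebra, 'a) presheaf" and G :: "('h, 'b) presheaf"
  assumes F: "is_presheaf F" and G: "is_presheaf G" and \<tau>: "\<tau> \<in> nt_hom F G" and x: "x \<in> sec F h"
  shows "Theta_arr (Delta_obj F) (Delta_obj G) (Delta_arr F G \<tau>) h (unit_nt F h x) = unit_nt G h (\<tau> h x)"
proof -
  have "fam_comp {()} (car (Delta_obj G)) (Delta_arr F G \<tau>) (unit_nt F h x) = unit_nt G h (\<tau> h x)"
    using graph_comp[OF relsheaf_Delta[OF G], of "\<lambda>_. (h, x)" "singleton_relsheaf h", OF _ rel_map_nt_pair[OF \<tau>]]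
      x nt_hom_sec[OF \<tau> x]
    by (simp add: Delta_arr_eq_graph[OF \<tau>] unit_nt_def comp_def nt_pair_def)
  then show ?thesis
    using unit_nt_sec[OF F x] by (simp add: Theta_arr_def Theta_obj_def)
qed

section \<open>The unit at a sheaf is bijective\<close>

context
  fixes G :: "('h::complete_heyting_algebra, 'a) presheaf"
  assumes G: "is_sheaf G"
begin

lemma unit_nt_inj:
  assumes x: "x \<in> sec G h" and y: "y \<in> sec G h" and eq: "unit_nt G h x = unit_nt G h y"
  shows "x = y"
proof -
  let ?A = "{m. m \<le> h \<and> rst G h m x = rst G h m y}"
  \<comment> \<open>Comparing the two columns at the entry \<open>(h, x)\<close> shows that the
    levels at which \<open>x\<close> and \<open>y\<close> coincide have supremum
    \<open>h\<close>.\<close>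
  have "agreement G (h, x) (h, x) = agreement G (h, x) (h, y)"
    using truth_unit_nt[OF sheaf_presheaf[OF G], of _ h "(h, x)"] eq x y by (metis fst_conv snd_conv)
  then have "Sup ?A = h" by (simp add: agreement_def[of G "(h, x)" "(h, y)"])
  then show ?thesis using sheaf_eqI[OF G, of x ?A y] x y by simp
qed

text \<open>Local preimages exist on the cover by truth values; injectivity makes them match, so
  they glue to a preimage.\<close>

lemma unit_nt_surj:
  assumes \<alpha>: "\<alpha> \<in> sec (TD G) h"
  shows "\<exists>y\<in>sec G h. unit_nt G h y = \<alpha>"
proof -
  note P = sheaf_presheaf[OF G]
  note D = relsheaf_Delta[OF P] and \<eta> = unit_nt_hom[OF P]
  let ?A = "(\<lambda>p. truth \<alpha> p ()) ` car (Delta_obj G)"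
  have h: "Sup ?A = h" by (rule Sup_truth_section[OF P \<alpha>])
  have le: "k \<le> h" if "k \<in> ?A" for k using Sup_upper[OF that] unfolding h .
  have "\<exists>x. x \<in> sec G k \<and> unit_nt G k x = rst (TD G) h k \<alpha>" if "k \<in> ?A" for k
  proof -
    from that obtain p where p: "snd p \<in> sec G (fst p)" and k: "k = truth \<alpha> p ()" by auto
    show ?thesis
      using unit_nt_locally_surj[OF P \<alpha> p] presheaf_rst[OF P _ p] unfolding k by metis
  qed
  then obtain x where x: "\<And>k. k \<in> ?A \<Longrightarrow> x k \<in> sec G k"
    and \<eta>x: "\<And>k. k \<in> ?A \<Longrightarrow> unit_nt G k (x k) = rst (TD G) h k \<alpha>" by metis
  have \<eta>rst: "unit_nt G m (rst G k m (x k)) = rst (TD G) h m \<alpha>" if "k \<in> ?A" "m \<le> k" for k m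
    using nt_hom_rst[OF \<eta> that(2) x[OF that(1)]] \<eta>x[OF that(1)]
      presheaf_rst_rst[OF presheaf_Theta[OF D] that(2) le[OF that(1)] \<alpha>] by simp
  have "matching_family G ?A x"
    unfolding matching_family_def
  proof (intro conjI ballI)
    fix k l assume k: "k \<in> ?A" and l: "l \<in> ?A"
    show "rst G k (inf k l) (x k) = rst G l (inf k l) (x l)"
      \<comment> \<open>Both restrictions are sent by the unit to the restriction of \<alpha> to
        \<open>inf k l\<close>.\<close>
      by (rule unit_nt_inj[of _ "inf k l"])
        (simp_all add: \<eta>rst[OF k] \<eta>rst[OF l] presheaf_rst[OF P _ x[OF k]] presheaf_rst[OF P _ x[OF l]])
  qed (rule x)
  then obtain y where "amalgamation G ?A x y"
    using G unfolding is_sheaf_def by blast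
  then have y: "y \<in> sec G h" and rst: "\<And>k. k \<in> ?A \<Longrightarrow> rst G h k y = x k"
    unfolding amalgamation_def h by blast+
  \<comment> \<open>The glued section is compared with \<alpha> on the same cover, now using that
    \<open>TD G\<close> is a sheaf.\<close>
  have "rst (TD G) h k (unit_nt G h y) = rst (TD G) h k \<alpha>" if "k \<in> ?A" for k
    using nt_hom_rst[OF \<eta> le[OF that] y] rst[OF that] \<eta>x[OF that] by simp
  then have "unit_nt G h y = \<alpha>"
    using sheaf_eqI[OF sheaf_Theta[OF D], of "unit_nt G h y" ?A \<alpha>] \<alpha> unit_nt_sec[OF P y]
    unfolding h by blast
  with y show ?thesis by blast
qed

lemma unit_nt_bij: "bij_betw (unit_nt G h) (sec G h) (sec (TD G) h)"
  unfolding bij_betw_def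
  using unit_nt_inj unit_nt_surj unit_nt_sec[OF sheaf_presheaf[OF G]]
  by (auto intro!: inj_onI) (metis image_eqI)

end

text \<open>Bijective components suffice: the naturality square of \<tau> yields that of the
  pointwise inverse. It provides the inverse of the unit at a sheaf.\<close>

lemma nt_inverse:
  assumes F: "is_presheaf F" and G: "is_presheaf G" and \<tau>: "\<tau> \<in> nt_hom F G"
    and bij: "\<And>h. bij_betw (\<tau> h) (sec F h) (sec G h)"
  obtains \<sigma> where "\<sigma> \<in> nt_hom G F" "\<And>h x. x \<in> sec F h \<Longrightarrow> \<sigma> h (\<tau> h x) = x"
    "\<And>h y. y \<in> sec G h \<Longrightarrow> \<tau> h (\<sigma> h y) = y"
proof -
  define \<sigma> where "\<sigma> = (\<lambda>h. \<lambda>y\<in>sec G h. inv_into (sec F h) (\<tau> h) y)"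
  have \<sigma>\<tau>: "\<sigma> h (\<tau> h x) = x" if "x \<in> sec F h" for h x
    using that nt_hom_sec[OF \<tau> that] bij_betw_inv_into_left[OF bij that] by (simp add: \<sigma>_def)
  have \<tau>\<sigma>: "\<tau> h (\<sigma> h y) = y" if "y \<in> sec G h" for h y
    using that bij_betw_inv_into_right[OF bij that] by (simp add: \<sigma>_def)
  have sec: "\<sigma> h y \<in> sec F h" if "y \<in> sec G h" for h y
    using that bij_betwE[OF bij_betw_inv_into[OF bij]] by (simp add: \<sigma>_def)
  have "\<sigma> \<in> nt_hom G F"
  proof (rule nt_homI)
    show "\<sigma> h \<in> extensional (sec G h)" for h by (simp add: \<sigma>_def)
    fix h y assume y: "y \<in> sec G h"
    show "\<sigma> h y \<in> sec F h" by (rule sec[OF y])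
    fix k assume kh: "k \<le> h"
    have "rst G h k y = \<tau> k (rst F h k (\<sigma> h y))"
      using nt_hom_rst[OF \<tau> kh sec[OF y]] \<tau>\<sigma>[OF y] by simp
    then show "\<sigma> k (rst G h k y) = rst F h k (\<sigma> h y)"
      using \<sigma>\<tau>[OF presheaf_rst[OF F kh sec[OF y]]] by simp
  qed
  then show ?thesis using \<sigma>\<tau> \<tau>\<sigma> that by blast
qed


section \<open>The functors\<close>

lemma category_PSh: "is_category (PSh :: (('h::order, 'a) presheaf, _) cat)"
proof -
  have id: "nt_comp F \<tau> (\<lambda>h. \<lambda>x\<in>sec F h. x) = \<tau> \<and> nt_comp F (\<lambda>h. \<lambda>x\<in>sec G h. x) \<tau> = \<tau>"
    if F: "is_presheaf F" and G: "is_presheaf G" and \<tau>: "\<tau> \<in> nt_hom F G"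
    for F G :: "('h, 'a) presheaf" and \<tau>
    using nt_hom_sec[OF \<tau>]
    by (intro conjI nt_hom_eqI[OF nt_comp_hom[OF F nt_id_hom[OF F] \<tau>] \<tau>]
        nt_hom_eqI[OF nt_comp_hom[OF F \<tau> nt_id_hom[OF G]] \<tau>]) simp_all
  have assoc: "nt_comp F (nt_comp G \<rho> \<sigma>) \<tau> = nt_comp F \<rho> (nt_comp F \<sigma> \<tau>)"
    if "\<tau> \<in> nt_hom F G" for F G :: "('h, 'a) presheaf" and \<rho> \<sigma> \<tau> :: "('h, 'a, 'a) nat_trans"
    using nt_hom_sec[OF that] by (auto simp: nt_comp_def compose_def fun_eq_iff restrict_def)
  show ?thesis
    using id assoc nt_comp_hom nt_id_hom by (auto simp: is_category_def PSh_def)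
qed

lemma full_subcategory:
  assumes "is_category C" "S \<subseteq> obj C"
  shows "is_category (C\<lparr>obj := S\<rparr>)"
  using assms unfolding is_category_def by (simp add: subset_iff)

lemma category_SHV: "is_category (SHV :: (('h::complete_lattice, 'a) presheaf, _) cat)"
  unfolding SHV_def
  by (rule full_subcategory[OF category_PSh]) (auto simp: PSh_def sheaf_presheaf)

text \<open>The section types of \<open>F\<close> and \<open>G\<close> may differ because
  transposition also applies the construction to transformations from a presheaf over
  \<open>'a\<close> to one over \<open>'b\<close>.\<close>

lemma Theta_Delta_hom:
  fixes F :: "('h::complete_heyting_algebra, 'a) presheaf" and G :: "('h, 'b) presheaf"
  assumes "is_presheaf F" "is_presheaf G" "\<tau> \<in> nt_hom F G"
  shows "Theta_arr (Delta_obj F) (Delta_obj G) (Delta_arr F G \<tau>) \<in> nt_hom (TD F) (TD G)"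
  using assms by (intro Theta_arr_hom relsheaf_Delta Delta_arr_rel_hom)

lemma Theta_Delta_comp:
  fixes F :: "('h::complete_heyting_algebra, 'a) presheaf" and G :: "('h, 'b) presheaf"
    and K :: "('h, 'c) presheaf"
  assumes "is_presheaf F" "is_presheaf G" "is_presheaf K" "\<tau> \<in> nt_hom F G" "\<sigma> \<in> nt_hom G K"
  shows "Theta_arr (Delta_obj F) (Delta_obj K) (Delta_arr F K (nt_comp F \<sigma> \<tau>)) =
    nt_comp (TD F) (Theta_arr (Delta_obj G) (Delta_obj K) (Delta_arr G K \<sigma>))
      (Theta_arr (Delta_obj F) (Delta_obj G) (Delta_arr F G \<tau>))"
  unfolding Delta_arr_comp[OF assms]
  using assms by (intro Theta_arr_comp relsheaf_Delta Delta_arr_rel_hom)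

lemma functor_a_Shv:
  "is_functor (a_Shv :: (('h::complete_heyting_algebra, 'a) presheaf, _, _, _) func)"
  using category_PSh[where 'h='h and 'a='a]
    category_SHV[where 'h='h and 'a="('h, unit, 'h \<times> 'a) relfam"]
  by (auto simp: is_functor_def a_Shv_def comp_func_def Theta_Shv_def Theta_Inf_def Delta_Inf_def
      PSh_def SHV_def sheaf_Theta relsheaf_Delta Theta_Delta_hom Delta_arr_id Theta_arr_id
      Theta_Delta_comp)

lemma functor_Theta_Delta_Shv:
  "is_functor (Theta_Inf \<circ>\<^sub>F
    (Delta_Shv :: (('h::complete_heyting_algebra, 'a) presheaf, _, _, _) func))"
  using category_SHV[where 'h='h and 'a='a]
    category_PSh[where 'h='h and 'a="('h, unit, 'h \<times> 'a) relfam"]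
  by (auto simp: is_functor_def Delta_Shv_def comp_func_def Theta_Inf_def Delta_Inf_def
      PSh_def SHV_def presheaf_Theta relsheaf_Delta Theta_Delta_hom Delta_arr_id Theta_arr_id
      Theta_Delta_comp sheaf_presheaf)

section \<open>The transposition bijection and its naturality\<close>

lemma transpose_bij:
  fixes F :: "('h::complete_heyting_algebra, 'a) presheaf" and G :: "('h, 'b) presheaf"
  assumes F: "is_presheaf F" and G: "is_sheaf G"
  shows "bij_betw (\<lambda>f. nt_comp F (unit_nt G) (nt_comp F f (unit_nt F)))
    (nt_hom (TD F) G) (nt_hom F (TD G))"
  unfolding bij_betw_def
proof
  note P = sheaf_presheaf[OF G]
  note \<eta>F = unit_nt_hom[OF F] and \<eta>G = unit_nt_hom[OF P] and TD = presheaf_Theta[OF relsheaf_Delta]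
  let ?\<phi> = "\<lambda>f. nt_comp F (unit_nt G) (nt_comp F f (unit_nt F))"
  have hom: "?\<phi> f \<in> nt_hom F (TD G)" if "f \<in> nt_hom (TD F) G" for f
    by (rule nt_comp_hom[OF F nt_comp_hom[OF F \<eta>F that] \<eta>G])
  show "inj_on ?\<phi> (nt_hom (TD F) G)"
  proof (rule inj_onI)
    fix f g assume f: "f \<in> nt_hom (TD F) G" and g: "g \<in> nt_hom (TD F) G" and eq: "?\<phi> f = ?\<phi> g"
    \<comment> \<open>Injectivity of the unit at \<open>G\<close> cancels the outer factor;
      agreement on the image of the unit at \<open>F\<close> then suffices.\<close>
    show "f = g"
    proof (rule nt_hom_TD_eqI[OF F G f g])
      fix h x assume x: "x \<in> sec F h"
      then have "unit_nt G h (f h (unit_nt F h x)) = unit_nt G h (g h (unit_nt F h x))"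
        using fun_cong[OF fun_cong[OF eq], of h x] by simp
      then show "f h (unit_nt F h x) = g h (unit_nt F h x)"
        using unit_nt_inj[OF G] nt_hom_sec[OF f] nt_hom_sec[OF g] nt_hom_sec[OF \<eta>F x] by blast
    qed
  qed
  obtain \<epsilon> where \<epsilon>: "\<epsilon> \<in> nt_hom (TD G) G"
    and \<epsilon>\<eta>: "\<And>h x. x \<in> sec G h \<Longrightarrow> \<epsilon> h (unit_nt G h x) = x"
    and \<eta>\<epsilon>: "\<And>h y. y \<in> sec (TD G) h \<Longrightarrow> unit_nt G h (\<epsilon> h y) = y"
    using nt_inverse[OF P TD[OF P] \<eta>G unit_nt_bij[OF G]] by blast
  have "\<exists>f\<in>nt_hom (TD F) G. ?\<phi> f = g" if g: "g \<in> nt_hom F (TD G)" for g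
  proof
    define g' where "g' = nt_comp F \<epsilon> g"
    have g': "g' \<in> nt_hom F G" unfolding g'_def by (rule nt_comp_hom[OF F g \<epsilon>])
    define f where "f = nt_comp (TD F) \<epsilon> (Theta_arr (Delta_obj F) (Delta_obj G) (Delta_arr F G g'))"
    show f: "f \<in> nt_hom (TD F) G"
      unfolding f_def by (rule nt_comp_hom[OF TD[OF F] Theta_Delta_hom[OF F P g'] \<epsilon>])
    show "?\<phi> f = g"
    proof (rule nt_hom_eqI[OF hom[OF f] g])
      fix h x assume x: "x \<in> sec F h"
      \<comment> \<open>Naturality of the unit slides it past \<open>g'\<close>, where
        \<open>\<epsilon>\<close> cancels it.\<close>
      have "f h (unit_nt F h x) = \<epsilon> h (unit_nt G h (g' h x))"
        using nt_hom_sec[OF \<eta>F x] by (simp add: f_def unit_nt_natural[OF F P g' x])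
      also have "\<dots> = g' h x" using \<epsilon>\<eta> nt_hom_sec[OF g' x] by blast
      finally show "?\<phi> f h x = g h x"
        using x \<eta>\<epsilon> nt_hom_sec[OF g x] by (simp add: g'_def)
    qed
  qed
  then show "?\<phi> ` nt_hom (TD F) G = nt_hom F (TD G)"
    using hom by blast
qed

text \<open>Two uses of naturality of the unit: along \<alpha> to move the unit at \<open>F'\<close>
  to the unit at \<open>F\<close>, and along \<beta> to move the unit at \<open>G\<close> to the
  unit at \<open>G'\<close>.\<close>

lemma transpose_natural:
  fixes F :: "('h::complete_heyting_algebra, 'a) presheaf" and G :: "('h, 'b) presheaf"
  assumes F: "is_presheaf F" and F': "is_presheaf F'" and G: "is_presheaf G" and G': "is_presheaf G'"
    and \<alpha>: "\<alpha> \<in> nt_hom F' F" and \<beta>: "\<beta> \<in> nt_hom G G'" and f: "f \<in> nt_hom (TD F) G"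
  shows "nt_comp F' (unit_nt G') (nt_comp F' (nt_comp (TD F') \<beta> (nt_comp (TD F') f
      (Theta_arr (Delta_obj F') (Delta_obj F) (Delta_arr F' F \<alpha>)))) (unit_nt F')) =
    nt_comp F' (Theta_arr (Delta_obj G) (Delta_obj G') (Delta_arr G G' \<beta>))
      (nt_comp F' (nt_comp F (unit_nt G) (nt_comp F f (unit_nt F))) \<alpha>)"
proof (rule nt_hom_eqI)
  note TD = presheaf_Theta[OF relsheaf_Delta]
  note \<eta> = unit_nt_hom[OF F] unit_nt_hom[OF F'] unit_nt_hom[OF G] unit_nt_hom[OF G']
    and TD\<alpha> = Theta_Delta_hom[OF F' F \<alpha>] and TD\<beta> = Theta_Delta_hom[OF G G' \<beta>]
  show "nt_comp F' (unit_nt G') (nt_comp F' (nt_comp (TD F') \<beta> (nt_comp (TD F') f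
      (Theta_arr (Delta_obj F') (Delta_obj F) (Delta_arr F' F \<alpha>)))) (unit_nt F')) \<in> nt_hom F' (TD G')"
    by (rule nt_comp_hom[OF F' nt_comp_hom[OF F' \<eta>(2) nt_comp_hom[OF TD[OF F']
            nt_comp_hom[OF TD[OF F'] TD\<alpha> f] \<beta>]] \<eta>(4)])
  show "nt_comp F' (Theta_arr (Delta_obj G) (Delta_obj G') (Delta_arr G G' \<beta>))
      (nt_comp F' (nt_comp F (unit_nt G) (nt_comp F f (unit_nt F))) \<alpha>) \<in> nt_hom F' (TD G')"
    by (rule nt_comp_hom[OF F' nt_comp_hom[OF F' \<alpha> nt_comp_hom[OF F
            nt_comp_hom[OF F \<eta>(1) f] \<eta>(3)]] TD\<beta>])
  fix h x assume x: "x \<in> sec F' h"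
  note \<alpha>x = nt_hom_sec[OF \<alpha> x]
  note f\<alpha>x = nt_hom_sec[OF f nt_hom_sec[OF \<eta>(1) \<alpha>x]]
  show "nt_comp F' (unit_nt G') (nt_comp F' (nt_comp (TD F') \<beta> (nt_comp (TD F') f
      (Theta_arr (Delta_obj F') (Delta_obj F) (Delta_arr F' F \<alpha>)))) (unit_nt F')) h x =
    nt_comp F' (Theta_arr (Delta_obj G) (Delta_obj G') (Delta_arr G G' \<beta>))
      (nt_comp F' (nt_comp F (unit_nt G) (nt_comp F f (unit_nt F))) \<alpha>) h x"
    using x \<alpha>x nt_hom_sec[OF \<eta>(2) x]
    by (simp add: unit_nt_natural[OF F' F \<alpha> x] unit_nt_natural[OF G G' \<beta> f\<alpha>x])
qed

theorem mainTheorem11: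
  shows "left_adjoint
    (a_Shv :: (('h::complete_heyting_algebra, 'a) presheaf, _, _, _) func)
    (Theta_Inf \<circ>\<^sub>F (Delta_Shv :: (('h, 'b) presheaf, _, _, _) func))"
proof -
  let ?\<phi> = "\<lambda>(F :: ('h, 'a) presheaf) (G :: ('h, 'b) presheaf) f.
    nt_comp F (unit_nt G) (nt_comp F f (unit_nt F))"
  let ?L = "a_Shv :: (('h, 'a) presheaf, _, _, _) func"
  let ?R = "Theta_Inf \<circ>\<^sub>F (Delta_Shv :: (('h, 'b) presheaf, _, _, _) func)"
  \<comment> \<open>Unfolding the functor records expresses the adjunction through \<open>TD\<close>
    and \<open>nt_hom\<close>, the form in which transposition was treated.\<close>
  have L: "obj (src ?L) = {F. is_presheaf F}" "hom (src ?L) = nt_hom"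
    "omap ?L F = TD F" "amap ?L F F' \<tau> = Theta_arr (Delta_obj F) (Delta_obj F') (Delta_arr F F' \<tau>)"
    for F F' \<tau>
    by (simp_all add: a_Shv_def comp_func_def Theta_Shv_def Theta_Inf_def Delta_Inf_def PSh_def)
  have R: "obj (src ?R) = {G. is_sheaf G}" "hom (src ?R) = nt_hom"
    "omap ?R G = TD G" "amap ?R G G' \<tau> = Theta_arr (Delta_obj G) (Delta_obj G') (Delta_arr G G' \<tau>)"
    for G G' \<tau>
    by (simp_all add: comp_func_def Theta_Inf_def Delta_Shv_def Delta_Inf_def SHV_def PSh_def)
  show ?thesis
    unfolding left_adjoint_def L R
    using functor_a_Shv functor_Theta_Delta_Shv transpose_bij transpose_natural sheaf_presheaf
    by (intro conjI exI[of _ ?\<phi>]) blast+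
qed

end
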